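(* Let $d$ be a positive integer and let $\mu$ be a finite positive Borel measure on the unit sphere $\partial\mathbb B^d$ of $\mathbb C^d$. Then for all polynomials $p,q\in\mathbb C[z_1,\ldots,z_d]$ and all $k\in\mathbb Z_+$, $$\sum_{|\gamma|=k}\frac{|\gamma|!}{\gamma!}\int_{\mathbb B^d}\big\langle \nabla (z^{\gamma}p)(z),\nabla (z^{\gamma}q)(z)\big\rangle\,P[\mu](z)\,dV(z)=\int_{\mathbb B^d}\langle\nabla p(z),\nabla q(z)\rangle\,P[\mu](z)\,dV(z)+kd\int_{\partial\mathbb B^d}p(\zeta)\overline{q(\zeta)}\,d\mu(\zeta),$$ where the sum is over $\gamma\in\mathbb Z_+^d$ with $|\gamma|=k$.
   Context: $\mathbb Z_+$ is the set of non-negative integers. For $\gamma\in\mathbb Z_+^d$: $|\gamma|=\gamma_1+\cdots+\gamma_d$, $\gamma!=\prod_j\gamma_j!$, $z^\gamma=\prod_j z_j^{\gamma_j}$. $\langle z,w\rangle=\sum_{j=1}^d z_j\overline{w_j}$ on $\mathbb C^d$ and $\|z\|=\langle z,z\rangle^{1/2}$; $\mathbb B^d=\{z\in\mathbb C^d:\|z\|<1\}$. $V$ is the normalized volume (Lebesgue) measure on $\mathbb B^d$, i.e. $V(\mathbb B^d)=1$. $\nabla=\big(\frac{\partial}{\partial z_1},\ldots,\frac{\partial}{\partial z_d}\big)$ is the complex gradient. The Poisson kernel is $P(z,\zeta)=\frac{1-\|z\|^2}{\|z-\zeta\|^{2d}}$ for $z\in\mathbb B^d$, $\zeta\in\partial\mathbb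 B^d$, and $P[\mu](z)=\int_{\partial\mathbb B^d}P(z,\zeta)\,d\mu(\zeta)$, $z\in\mathbb B^d$. *)

theory Defs
  imports "HOL-Analysis.Analysis" "HOL-Library.Poly_Mapping"
begin

text \<open>\<open>\<complex>\<^sup>d\<close> is \<^typ>\<open>complex ^ 'n\<close> with \<open>d = CARD('n)\<close>; the library norm on it is the
  Euclidean one. Multi-indices are \<^typ>\<open>'n \<Rightarrow>\<^sub>0 nat\<close>, which for a finite type
  \<^typ>\<open>'n\<close> are all functions \<^typ>\<open>'n \<Rightarrow> nat\<close>.\<close>

type_synonym 'n multi_index = "'n \<Rightarrow>\<^sub>0 nat"

text \<open>The polynomial ring \<open>\<complex>[z\<^sub>1, \<dots>, z\<^sub>d]\<close>: finitely supported families of coefficients, whose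
  library multiplication is the convolution product.\<close>

type_synonym 'n cpoly = "'n multi_index \<Rightarrow>\<^sub>0 complex"

definition mi_abs :: "('n::finite) multi_index \<Rightarrow> nat" where
  "mi_abs \<gamma> = (\<Sum>j\<in>UNIV. Poly_Mapping.lookup \<gamma> j)"

definition mi_fact :: "('n::finite) multi_index \<Rightarrow> nat" where
  "mi_fact \<gamma> = (\<Prod>j\<in>UNIV. fact (Poly_Mapping.lookup \<gamma> j))"

definition mi_pow :: "complex ^ 'n \<Rightarrow> ('n::finite) multi_index \<Rightarrow> complex" where
  "mi_pow z \<gamma> = (\<Prod>j\<in>UNIV. (z $ j) ^ Poly_Mapping.lookup \<gamma> j)"

definition zmonom :: "('n::finite) multi_index \<Rightarrow> 'n cpoly" where
  "zmonom \<gamma> = Poly_Mapping.single \<gamma> 1"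

definition peval :: "('n::finite) cpoly \<Rightarrow> complex ^ 'n \<Rightarrow> complex" where
  "peval p z = (\<Sum>\<gamma>\<in>Poly_Mapping.keys p. Poly_Mapping.lookup p \<gamma> * mi_pow z \<gamma>)"

text \<open>The library inner product on \<^typ>\<open>complex ^ 'n\<close> is the real part of this one.\<close>

definition herm :: "complex ^ 'n \<Rightarrow> complex ^ ('n::finite) \<Rightarrow> complex" where
  "herm z w = (\<Sum>j\<in>UNIV. z $ j * cnj (w $ j))"

text \<open>The \<open>j\<close>-th component is the complex derivative in the \<open>j\<close>-th variable, the other
  coordinates being kept fixed.\<close>

definition cgrad :: "(complex ^ 'n \<Rightarrow> complex) \<Rightarrow> complex ^ 'n \<Rightarrow> complex ^ ('n::finite)" where
  "cgrad f z = (\<chi> j. deriv (\<lambda>w. f (\<chi> i. if i = j then w else z $ i)) (z $ j))"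

definition vol :: "(complex ^ ('n::finite)) measure" where
  "vol = uniform_measure lborel (ball 0 1)"

definition poisson_kernel :: "complex ^ 'n \<Rightarrow> complex ^ ('n::finite) \<Rightarrow> real" where
  "poisson_kernel z \<zeta> = (1 - (norm z)\<^sup>2) / norm (z - \<zeta>) ^ (2 * CARD('n))"

definition poisson :: "(complex ^ 'n) measure \<Rightarrow> complex ^ ('n::finite) \<Rightarrow> real" where
  "poisson \<mu> z = (LINT \<zeta>|\<mu>. poisson_kernel z \<zeta>)"

end

theory Submission
  imports Defs
begin

text \<open>Since \<open>z\<^sup>\<gamma>\<close> is a product of coordinates, Pascal's rule for multinomial coefficients and
  \<open>\<Sum>\<^sub>j |\<zeta>\<^sub>j|\<^sup>2 = 1\<close> on the sphere reduce the identity to \<open>k = 1\<close> by induction. There the product rule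
  gives, with \<open>u\<close> the product of \<open>p\<close> and the conjugate of \<open>q\<close>,
  \<open>\<Sum>\<^sub>j \<langle>\<nabla>(z\<^sub>j p), \<nabla>(z\<^sub>j q)\<rangle> - \<langle>\<nabla>p, \<nabla>q\<rangle> = - \<Delta>((1 - |z|\<^sup>2) u) / 4\<close>. By Fubini it remains to integrate this
  against the Poisson kernel of one boundary point \<open>\<zeta>\<close>, where the value \<open>d u(\<zeta>)\<close> is expected from
  Green's formula. No surface integrals are needed: if \<open>P = (1 - |z|\<^sup>2) K\<close> and \<open>v = (1 - |z|\<^sup>2) u\<close>, then
  \<open>P \<nabla>v - v \<nabla>P = (1 - |z|\<^sup>2)\<^sup>2 (K \<nabla>u - u \<nabla>K)\<close> vanishes on the sphere, so its divergence has integral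
  zero as soon as the pole of \<open>K\<close> is moved from \<open>\<zeta>\<close> to a point outside the closed ball. Letting the pole
  return to \<open>\<zeta>\<close> shows that the integral vanishes if \<open>u(\<zeta>) = 0\<close>; constant \<open>u\<close> is covered by the mean
  value property of the Poisson kernel.\<close>

section \<open>Integration by parts on the unit ball\<close>

text \<open>The sphere has volume zero, so a kink that an extension by zero may have there does not
  disturb almost everywhere convergence of difference quotients.\<close>

lemma AE_norm_neq_1: "AE x :: 'a::euclidean_space in lborel. norm x \<noteq> 1"
proof -
  have "sphere (0::'a) 1 \<in> null_sets lborel"
    using negligible_sphere[of "0::'a" 1]
    by (auto simp: null_sets_completion_iff negligible_iff_null_sets)
  from AE_not_in[OF this] show ?thesis by simp
qed

text \<open>Along a line, meeting the sphere is a quadratic equation with leading coefficient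
  \<open>b \<bullet> b\<close>, nonzero for \<open>b \<noteq> 0\<close>. Finitely many exceptional
  parameters are what the strong fundamental theorem of calculus tolerates.\<close>

lemma finite_line_Int_sphere:
  fixes x b :: "'a::euclidean_space"
  assumes "b \<noteq> 0"
  shows "finite {s. norm (x + s *\<^sub>R b) = 1}"
proof (rule finite_subset)
  let ?q = "[:x \<bullet> x - 1, 2 * (x \<bullet> b), b \<bullet> b:]"
  have "?q \<noteq> 0"
    using assms by simp
  then show "finite {s. poly ?q s = 0}"
    by (rule poly_roots_finite)
  show "{s. norm (x + s *\<^sub>R b) = 1} \<subseteq> {s. poly ?q s = 0}"
    by (auto simp: norm_eq_1 inner_simps inner_commute algebra_simps power2_eq_square)
qed

lemma lborel_integral_translate:
  fixes f :: "'a::euclidean_space \<Rightarrow> 'b::{banach, second_countable_topology}"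
  assumes [measurable]: "f \<in> borel_measurable borel"
  shows "(LINT x|lborel. f (x + c)) = (LINT x|lborel. f x)"
proof -
  have "(LINT x|lborel. f x) = (LINT x|distr lborel borel ((+) c). f x)"
    by (simp only: lborel_distr_plus)
  also have "\<dots> = (LINT x|lborel. f (c + x))"
    by (rule integral_distr) auto
  finally show ?thesis
    by (simp add: add.commute)
qed

lemma lborel_integrable_translate:
  fixes f :: "'a::euclidean_space \<Rightarrow> 'b::{banach, second_countable_topology}"
  assumes "integrable lborel f"
  shows "integrable lborel (\<lambda>x. f (x + c))"
proof -
  have "integrable (distr lborel borel ((+) c)) f"
    using assms by (simp only: lborel_distr_plus)
  then have "integrable lborel (\<lambda>x. f (c + x))"
    by (rule integrable_distr[rotated]) auto
  then show ?thesis
    by (simp add: add.commute)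
qed

text \<open>The extension by zero of \<open>f\<close> is Lipschitz in the direction \<open>b\<close>, so its difference quotients
  are bounded; their integrals vanish by translation invariance.\<close>

lemma integral_directional_deriv_ball:
  fixes f g :: "'a::euclidean_space \<Rightarrow> 'b::euclidean_space"
  assumes cf: "continuous_on (cball 0 1) f" and cg: "continuous_on (cball 0 1) g"
    and df: "\<And>x. norm x < 1 \<Longrightarrow> ((\<lambda>t. f (x + t *\<^sub>R b)) has_vector_derivative g x) (at 0)"
    and f0: "\<And>x. norm x = 1 \<Longrightarrow> f x = 0"
    and b: "norm b = 1"
  shows "(LINT x:ball 0 1|lborel. g x) = 0"
proof -
  define F where "F x = (if x \<in> cball 0 1 then f x else 0)" for x
  define G where "G x = (if x \<in> ball 0 1 then g x else 0)" for x
  obtain C where C: "norm (g x) \<le> C" if "norm x \<le> 1" for x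
    using compact_imp_bounded[OF compact_continuous_image[OF cg compact_cball]]
    unfolding bounded_iff by (metis imageI mem_cball_0)
  have C0: "0 \<le> C"
    using order_trans[OF norm_ge_zero C[of 0]] by simp
  \<comment> \<open>The closed pieces \<open>cball 0 1\<close> and \<open>- ball 0 1\<close> overlap
    in the sphere, where \<open>f\<close> vanishes, so the two definitions agree there.\<close>
  have contF: "continuous_on UNIV F"
  proof -
    have "continuous_on (cball 0 1 \<union> - ball 0 1) (\<lambda>x. if x \<in> cball 0 1 then f x else 0)"
      using cf f0 by (intro continuous_on_If) (auto simp: dist_norm)
    moreover have "cball 0 1 \<union> - ball 0 1 = (UNIV :: 'a set)"
      by auto
    ultimately show ?thesis
      by (simp add: F_def[abs_def])
  qed
  have derF: "((\<lambda>t. F (x + t *\<^sub>R b)) has_vector_derivative G (x + s *\<^sub>R b)) (at s)"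
    if "norm (x + s *\<^sub>R b) \<noteq> 1" for x s
  proof (cases "norm (x + s *\<^sub>R b) < 1")
    case True
    have "((\<lambda>t. t - s) has_vector_derivative 1) (at s)"
      by (auto intro!: derivative_eq_intros)
    moreover have "((\<lambda>t. f (x + s *\<^sub>R b + t *\<^sub>R b)) has_vector_derivative g (x + s *\<^sub>R b)) (at (s - s))"
      using df[OF True] by simp
    ultimately have "((\<lambda>t. f (x + s *\<^sub>R b + t *\<^sub>R b)) \<circ> (\<lambda>t. t - s) has_vector_derivative 1 *\<^sub>R g (x + s *\<^sub>R b)) (at s)"
      by (rule vector_diff_chain_at)
    then have *: "((\<lambda>t. f (x + t *\<^sub>R b)) has_vector_derivative g (x + s *\<^sub>R b)) (at s)"
      by (simp add: o_def algebra_simps)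
    have "open ((\<lambda>t. x + t *\<^sub>R b) -` ball 0 1)"
      by (intro open_vimage continuous_intros) auto
    from has_vector_derivative_transform_within_open[OF * this, of "\<lambda>t. F (x + t *\<^sub>R b)"] True
    show ?thesis
      by (auto simp: F_def G_def)
  next
    case False
    have "open ((\<lambda>t. x + t *\<^sub>R b) -` (- cball 0 1))"
      by (intro open_vimage continuous_intros) auto
    from has_vector_derivative_transform_within_open[OF has_vector_derivative_const[of 0] this, of s "\<lambda>t. F (x + t *\<^sub>R b)"]
      False that
    show ?thesis
      by (auto simp: F_def G_def)
  qed
  \<comment> \<open>\<open>F\<close> is recovered from \<open>G\<close> by the fundamental theorem
    of calculus, the crossings of the sphere being the exceptional points; \<open>C\<close> bounds
    \<open>G\<close>.\<close>
  have lip: "norm (F (x + t *\<^sub>R b) - F x) \<le> C * t" if "t \<ge> 0" for x t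
  proof -
    have "b \<noteq> 0"
      using b by auto
    have "((\<lambda>s. G (x + s *\<^sub>R b)) has_integral (F (x + t *\<^sub>R b) - F (x + 0 *\<^sub>R b))) {0..t}"
    proof (rule fundamental_theorem_of_calculus_strong[OF finite_line_Int_sphere[OF \<open>b \<noteq> 0\<close>, of x] that])
      show "continuous_on {0..t} (\<lambda>s. F (x + s *\<^sub>R b))"
        by (intro continuous_on_compose2[OF contF] continuous_intros) auto
    qed (use derF in auto)
    from has_integral_bound[of C, OF C0 this[folded cbox_interval]] show ?thesis
      using C C0 that by (auto simp: G_def)
  qed
  have mF: "F \<in> borel_measurable borel"
    using contF by (rule borel_measurable_continuous_onI)
  have mG: "G \<in> borel_measurable borel"
    unfolding G_def[abs_def]
    by (rule borel_measurable_continuous_on_if) (auto intro: continuous_on_subset[OF cg])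
  have intF: "integrable lborel F"
  proof -
    have "integrable lborel (\<lambda>x. indicator (cball 0 1) x *\<^sub>R f x)"
      by (rule borel_integrable_compact[unfolded set_integrable_def]) (auto intro: cf)
    moreover have "(\<lambda>x. indicator (cball 0 1) x *\<^sub>R f x) = F"
      by (auto simp: F_def indicator_def)
    ultimately show ?thesis by simp
  qed
  define D where "D n x = real (Suc n) *\<^sub>R (F (x + (1 / real (Suc n)) *\<^sub>R b) - F x)" for n x
  have intD: "(LINT x|lborel. D n x) = 0" for n
    unfolding D_def
    using lborel_integrable_translate[OF intF, of "(1 / real (Suc n)) *\<^sub>R b"] intF
      lborel_integral_translate[OF mF, of "(1 / real (Suc n)) *\<^sub>R b"]
    by simp
  \<comment> \<open>Step lengths are at most 1, so \<open>D n\<close> vanishes outside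
    \<open>cball 0 2\<close>; inside, the Lipschitz bound gives \<open>C\<close>.\<close>
  have "(\<lambda>n. LINT x|lborel. D n x) \<longlonglongrightarrow> (LINT x|lborel. G x)"
  proof (rule integral_dominated_convergence[where w = "\<lambda>x. C * indicator (cball 0 2) x"])
    show "G \<in> borel_measurable lborel" "D i \<in> borel_measurable lborel" for i
      unfolding D_def using mF mG by measurable
    show "integrable lborel (\<lambda>x::'a. C * indicator (cball 0 2) x)"
      by (intro integrable_mult_right integrable_real_indicator) (auto intro!: emeasure_bounded_finite[unfolded infinity_ennreal_def])
    show "AE x in lborel. norm (D n x) \<le> C * indicator (cball 0 2) x" for n
    proof (rule AE_I2)
      fix x :: 'a
      show "norm (D n x) \<le> C * indicator (cball 0 2) x"
      proof (cases "norm x \<le> 2")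
        case True
        have "norm (D n x) \<le> real (Suc n) * (C * (1 / real (Suc n)))"
          unfolding D_def norm_scaleR using lip[of "1 / real (Suc n)" x]
          by (intro mult_mono) auto
        also have "\<dots> = C"
          by simp
        finally show ?thesis
          using True by simp
      next
        case False
        have "norm x \<le> norm (x + (1 / real (Suc n)) *\<^sub>R b) + norm ((1 / real (Suc n)) *\<^sub>R b)"
          by (metis add_diff_cancel norm_triangle_ineq4)
        moreover have "norm ((1 / real (Suc n)) *\<^sub>R b) \<le> 1"
          using b by (simp add: field_simps)
        ultimately have "norm (x + (1 / real (Suc n)) *\<^sub>R b) > 1"
          using False by linarith
        then show ?thesis
          using False by (auto simp: D_def F_def)
      qed
    qed
    show "AE x in lborel. (\<lambda>n. D n x) \<longlonglongrightarrow> G x"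
      using AE_norm_neq_1
    proof eventually_elim
      case (elim x)
      have "((\<lambda>t. F (x + t *\<^sub>R b)) has_vector_derivative G x) (at 0)"
        using derF[of x 0] elim by simp
      then have "((\<lambda>h. norm (F (x + h *\<^sub>R b) - F x - h *\<^sub>R G x) / \<bar>h\<bar>) \<longlongrightarrow> 0) (at 0)"
        by (simp add: has_vector_derivative_def has_derivative_at)
      moreover have "filterlim (\<lambda>n. 1 / real (Suc n)) (at 0) sequentially"
        by (rule filterlim_atI) (use LIMSEQ_inverse_real_of_nat in \<open>auto simp: inverse_eq_divide\<close>)
      ultimately have "(\<lambda>n. norm (F (x + (1 / real (Suc n)) *\<^sub>R b) - F x - (1 / real (Suc n)) *\<^sub>R G x)
                         / \<bar>1 / real (Suc n)\<bar>) \<longlonglongrightarrow> 0"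
        by (rule filterlim_compose)
      moreover have "norm (F (x + (1 / real (Suc n)) *\<^sub>R b) - F x - (1 / real (Suc n)) *\<^sub>R G x)
                         / \<bar>1 / real (Suc n)\<bar> = norm (D n x - G x)" for n
      proof -
        have "D n x - G x = real (Suc n) *\<^sub>R
            (F (x + (1 / real (Suc n)) *\<^sub>R b) - F x - (1 / real (Suc n)) *\<^sub>R G x)"
          by (simp add: D_def scaleR_diff_right del: of_nat_Suc)
        then show ?thesis
          by (simp add: mult.commute del: of_nat_Suc)
      qed
      ultimately show ?case
        by (simp only: tendsto_norm_zero_iff LIM_zero_iff)
    qed
  qed
  then have "(LINT x|lborel. G x) = 0"
    by (simp add: intD LIMSEQ_const_iff)
  moreover have "G = (\<lambda>x. indicator (ball 0 1) x *\<^sub>R g x)"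
    by (auto simp: G_def indicator_def)
  ultimately show ?thesis
    by (simp add: set_lebesgue_integral_def)
qed

section \<open>Green's identity\<close>

text \<open>This is \<open>|x - a|\<close> to the power \<open>- 2 m\<close>; the inner product
  keeps square roots out of the derivatives. Together with the next definition, the Poisson kernel
  of a boundary point \<open>\<zeta>\<close> is
  \<open>defect x * inv_dist_pow \<zeta> d x\<close>.\<close>

definition inv_dist_pow :: "'a::real_inner \<Rightarrow> nat \<Rightarrow> 'a \<Rightarrow> real" where
  "inv_dist_pow a m x = inverse ((x - a) \<bullet> (x - a)) ^ m"

definition defect :: "'a::real_inner \<Rightarrow> real" where
  "defect x = 1 - x \<bullet> x"

lemma inv_dist_pow_nonneg [simp]: "0 \<le> inv_dist_pow a m x"
  by (simp add: inv_dist_pow_def)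

lemma inv_dist_pow_Suc: "x \<noteq> a \<Longrightarrow> (x - a) \<bullet> (x - a) * inv_dist_pow a (Suc m) x = inv_dist_pow a m x"
  by (simp add: inv_dist_pow_def)

lemma defect_line: "((\<lambda>t. defect (x + t *\<^sub>R b)) has_real_derivative - 2 * (x \<bullet> b)) (at 0)"
  unfolding defect_def by (auto intro!: derivative_eq_intros simp: inner_simps inner_commute)

lemma defect_sq_line:
  "((\<lambda>t. (defect (x + t *\<^sub>R b))\<^sup>2) has_real_derivative - 4 * defect x * (x \<bullet> b)) (at 0)"
  using DERIV_power[OF defect_line[of x b], of 2] by (simp add: mult_ac)

lemma inner_line: "((\<lambda>t. (x + t *\<^sub>R b - a) \<bullet> c) has_real_derivative b \<bullet> c) (at 0)"
  by (auto intro!: derivative_eq_intros simp: inner_simps)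

lemma inv_dist_pow_line:
  assumes "x \<noteq> a"
  shows "((\<lambda>t. inv_dist_pow a m (x + t *\<^sub>R b)) has_real_derivative
            - 2 * real m * ((x - a) \<bullet> b) * inv_dist_pow a (Suc m) x) (at 0)"
proof -
  have "((\<lambda>t. (x + t *\<^sub>R b - a) \<bullet> (x + t *\<^sub>R b - a)) has_real_derivative 2 * ((x - a) \<bullet> b)) (at 0)"
    by (auto intro!: derivative_eq_intros simp: inner_simps inner_commute)
  from DERIV_power[OF DERIV_inverse'[OF this], of m] assms
  have "((\<lambda>t. inv_dist_pow a m (x + t *\<^sub>R b)) has_real_derivative
      real m * (- (inverse ((x - a) \<bullet> (x - a)) * (2 * ((x - a) \<bullet> b)) * inverse ((x - a) \<bullet> (x - a)))
        * inverse ((x - a) \<bullet> (x - a)) ^ (m - Suc 0))) (at 0)"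
    unfolding inv_dist_pow_def by simp
  \<comment> \<open>The case \<open>m = 0\<close> is separate because the power rule leaves the
    truncated exponent \<open>m - Suc 0\<close>.\<close>
  then show ?thesis
    by (rule DERIV_cong) (cases m; simp add: inv_dist_pow_def algebra_simps)
qed

lemma continuous_on_inv_dist_pow [continuous_intros]:
  assumes "continuous_on S f" "\<And>x. x \<in> S \<Longrightarrow> f x \<noteq> a"
  shows "continuous_on S (\<lambda>x. inv_dist_pow a m (f x))"
  unfolding inv_dist_pow_def using assms by (auto intro!: continuous_intros)

lemma continuous_on_defect [continuous_intros]:
  "continuous_on S f \<Longrightarrow> continuous_on S (\<lambda>x. defect (f x))"
  unfolding defect_def by (intro continuous_intros)

lemma sum_Basis_inner_mult:
  fixes x y :: "'a::euclidean_space"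
  shows "(\<Sum>b\<in>Basis. (x \<bullet> b) * (y \<bullet> b)) = x \<bullet> y"
  by (simp add: euclidean_inner[of x y])

lemma continuous_imp_set_integrable_unit_ball:
  fixes f :: "'a::euclidean_space \<Rightarrow> 'b::euclidean_space"
  assumes "continuous_on (cball 0 1) f"
  shows "set_integrable lborel (ball 0 1) f"
proof (rule set_integrable_subset)
  show "set_integrable lborel (cball 0 1) f"
    unfolding set_integrable_def by (rule borel_integrable_compact) (use assms in auto)
qed auto

lemma set_integral_sum:
  fixes f :: "'i \<Rightarrow> 'a \<Rightarrow> 'b::{banach, second_countable_topology}"
  assumes "\<And>i. i \<in> I \<Longrightarrow> set_integrable M A (f i)"
  shows "(LINT x:A|M. (\<Sum>i\<in>I. f i x)) = (\<Sum>i\<in>I. LINT x:A|M. f i x)"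
  using assms unfolding set_integrable_def set_lebesgue_integral_def scaleR_sum_right
  by (rule Bochner_Integration.integral_sum)

text \<open>\<open>\<Delta>((1 - |x|\<^sup>2) w) = - green_op d w1 w2 w\<close> when \<open>w1 b\<close>, \<open>w2 b\<close> are the first and second
  derivatives of \<open>w\<close> along the basis vectors \<open>b\<close> and \<open>2 d\<close> is the dimension.\<close>

definition green_op ::
  "nat \<Rightarrow> ('a::euclidean_space \<Rightarrow> 'a \<Rightarrow> 'b::real_vector) \<Rightarrow> ('a \<Rightarrow> 'a \<Rightarrow> 'b) \<Rightarrow> ('a \<Rightarrow> 'b) \<Rightarrow> 'a \<Rightarrow> 'b" where
  "green_op d w1 w2 w x = (4 * real d) *\<^sub>R w x + (\<Sum>b\<in>Basis. (4 * (x \<bullet> b)) *\<^sub>R w1 b x)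
     - defect x *\<^sub>R (\<Sum>b\<in>Basis. w2 b x)"

text \<open>The divergence of \<open>(1 - |x|\<^sup>2)\<^sup>2 (K \<nabla>w - w \<nabla>K)\<close> with \<open>K x = |x - a|\<close> to the power \<open>- 2 d\<close>.
  Since this field is \<open>P \<nabla>v - v \<nabla>P\<close> for \<open>P = (1 - |x|\<^sup>2) K\<close> and \<open>v = (1 - |x|\<^sup>2) w\<close>, this is Green's
  second identity; the right-hand side appears because \<open>P\<close> is not harmonic for \<open>|a| > 1\<close>.\<close>

lemma green_identity:
  fixes w :: "'a::euclidean_space \<Rightarrow> 'b::euclidean_space"
  assumes dim: "DIM('a) = 2 * d" and a: "1 < norm a"
    and c0: "continuous_on UNIV w"
    and c1: "\<And>b. b \<in> Basis \<Longrightarrow> continuous_on UNIV (w1 b)"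
    and c2: "\<And>b. b \<in> Basis \<Longrightarrow> continuous_on UNIV (w2 b)"
    and d1: "\<And>b x. b \<in> Basis \<Longrightarrow> ((\<lambda>t. w (x + t *\<^sub>R b)) has_vector_derivative w1 b x) (at 0)"
    and d2: "\<And>b x. b \<in> Basis \<Longrightarrow> ((\<lambda>t. w1 b (x + t *\<^sub>R b)) has_vector_derivative w2 b x) (at 0)"
  shows "(LINT x:ball 0 1|lborel. (defect x * inv_dist_pow a d x) *\<^sub>R green_op d w1 w2 w x)
       = (LINT x:ball 0 1|lborel. (4 * real d * (a \<bullet> a - 1) * defect x * inv_dist_pow a (Suc d) x) *\<^sub>R w x)"
proof -
  have xa: "x \<noteq> a" if "norm x \<le> 1" for x
    using a that by auto
  \<comment> \<open>First and second derivatives of \<open>inv_dist_pow a d\<close> along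
    \<open>b\<close>, the second one with \<open>b \<bullet> b = 1\<close> already inserted. Then
    \<open>g b\<close> is the derivative along \<open>b\<close> of the \<open>b\<close>-component of
    the vector field.\<close>
  define K1 where "K1 b x = - 2 * real d * ((x - a) \<bullet> b) * inv_dist_pow a (Suc d) x" for b x
  define K2 where "K2 b x = - 2 * real d * inv_dist_pow a (Suc d) x
      + 4 * real d * real (Suc d) * ((x - a) \<bullet> b)\<^sup>2 * inv_dist_pow a (Suc (Suc d)) x" for b x
  define g where "g b x = ((defect x)\<^sup>2 * inv_dist_pow a d x) *\<^sub>R w2 b x
      - (4 * defect x * (x \<bullet> b) * inv_dist_pow a d x) *\<^sub>R w1 b x
      + (4 * defect x * (x \<bullet> b) * K1 b x - (defect x)\<^sup>2 * K2 b x) *\<^sub>R w x" for b x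
  note cont = c0[THEN continuous_on_subset] c1[THEN continuous_on_subset] c2[THEN continuous_on_subset]
  have cg: "continuous_on (cball 0 1) (g b)" if "b \<in> Basis" for b
    unfolding g_def K1_def K2_def using that xa
    by (intro continuous_intros cont) auto
  have K1: "((\<lambda>t. inv_dist_pow a d (x + t *\<^sub>R b)) has_real_derivative K1 b x) (at 0)"
    if "norm x < 1" for b x
    unfolding K1_def by (rule inv_dist_pow_line) (use xa[of x] that in auto)
  have K2: "((\<lambda>t. K1 b (x + t *\<^sub>R b)) has_real_derivative K2 b x) (at 0)"
    if "norm x < 1" "b \<in> Basis" for b x
  proof -
    have "x \<noteq> a"
      using xa[of x] that by auto
    from DERIV_mult[OF DERIV_cmult[OF inner_line[of x b a b], of "- 2 * real d"]
          inv_dist_pow_line[OF this, of "Suc d" b]]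
    show ?thesis
      unfolding K1_def by (rule DERIV_cong) (use that(2) in \<open>simp add: K2_def power2_eq_square algebra_simps\<close>)
  qed
  have zero: "(LINT x:ball 0 1|lborel. g b x) = 0" if b: "b \<in> Basis" for b
  proof (rule integral_directional_deriv_ball)
    let ?f = "\<lambda>x. ((defect x)\<^sup>2 * inv_dist_pow a d x) *\<^sub>R w1 b x - ((defect x)\<^sup>2 * K1 b x) *\<^sub>R w x"
    show "continuous_on (cball 0 1) ?f"
      unfolding K1_def using b xa
      by (intro continuous_intros cont) auto
    show "continuous_on (cball 0 1) (g b)"
      by (rule cg[OF b])
    show "?f x = 0" if "norm x = 1" for x
      using that by (simp add: defect_def norm_eq_1)
    show "norm b = 1"
      using b by simp
    fix x :: 'a
    assume x: "norm x < 1"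
    have 1: "((\<lambda>t. (defect (x + t *\<^sub>R b))\<^sup>2 * inv_dist_pow a d (x + t *\<^sub>R b)) has_real_derivative
        - 4 * defect x * (x \<bullet> b) * inv_dist_pow a d x + (defect x)\<^sup>2 * K1 b x) (at 0)"
      by (rule DERIV_cong[OF DERIV_mult[OF defect_sq_line K1[OF x]]])
        (simp add: algebra_simps)
    have 2: "((\<lambda>t. (defect (x + t *\<^sub>R b))\<^sup>2 * K1 b (x + t *\<^sub>R b)) has_real_derivative
        - 4 * defect x * (x \<bullet> b) * K1 b x + (defect x)\<^sup>2 * K2 b x) (at 0)"
      by (rule DERIV_cong[OF DERIV_mult[OF defect_sq_line K2[OF x b]]])
        (simp add: algebra_simps)
    show "((\<lambda>t. ?f (x + t *\<^sub>R b)) has_vector_derivative g b x) (at 0)"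
      using has_vector_derivative_diff[OF has_vector_derivative_scaleR[OF 1 d2[OF b, of x]]
          has_vector_derivative_scaleR[OF 2 d1[OF b, of x]]]
      by (simp add: g_def algebra_simps)
  qed
  have sumg: "(\<Sum>b\<in>Basis. g b x) =
      (4 * real d * (a \<bullet> a - 1) * defect x * inv_dist_pow a (Suc d) x) *\<^sub>R w x
      - (defect x * inv_dist_pow a d x) *\<^sub>R green_op d w1 w2 w x" if "norm x < 1" for x
  proof -
    have x: "x \<noteq> a"
      using xa[of x] that by auto
    let ?N = "(x - a) \<bullet> (x - a)"
    have S1: "(\<Sum>b\<in>Basis. (x \<bullet> b) * K1 b x) = - 2 * real d * ((x - a) \<bullet> x) * inv_dist_pow a (Suc d) x"
    proof -
      have "(\<Sum>b\<in>Basis. (x \<bullet> b) * K1 b x)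
          = - 2 * real d * inv_dist_pow a (Suc d) x * (\<Sum>b\<in>Basis. ((x - a) \<bullet> b) * (x \<bullet> b))"
        unfolding K1_def sum_distrib_left by (intro sum.cong) (auto simp: mult_ac)
      then show ?thesis
        unfolding sum_Basis_inner_mult by simp
    qed
    have S2: "(\<Sum>b\<in>Basis. K2 b x) = 4 * real d * inv_dist_pow a (Suc d) x"
    proof -
      have "(\<Sum>b\<in>Basis. K2 b x) = - 2 * real d * inv_dist_pow a (Suc d) x * DIM('a)
         + 4 * real d * real (Suc d) * inv_dist_pow a (Suc (Suc d)) x * (\<Sum>b\<in>Basis. ((x - a) \<bullet> b) * ((x - a) \<bullet> b))"
        unfolding K2_def sum_distrib_left sum.distrib
        by (intro arg_cong2[where f = "(+)"] sum.cong) (auto simp: mult_ac power2_eq_square)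
      also have "\<dots> = - 2 * real d * inv_dist_pow a (Suc d) x * (2 * real d)
         + 4 * real d * real (Suc d) * (?N * inv_dist_pow a (Suc (Suc d)) x)"
        unfolding sum_Basis_inner_mult dim by simp
      finally show ?thesis
        unfolding inv_dist_pow_Suc[OF x] by (simp add: algebra_simps)
    qed
    \<comment> \<open>Expressing the inner product through \<open>?N\<close> lets one power of the
      distance be absorbed by \<open>inv_dist_pow_Suc\<close>. What remains is a multiple of
      \<open>1 - a \<bullet> a\<close>, which would vanish for a pole on the sphere.\<close>
    have "2 * ((x - a) \<bullet> x) = ?N + (x \<bullet> x - a \<bullet> a)"
      by (simp add: inner_simps inner_commute)
    then have "4 * defect x * (- 2 * real d * ((x - a) \<bullet> x) * inv_dist_pow a (Suc d) x)
        - (defect x)\<^sup>2 * (4 * real d * inv_dist_pow a (Suc d) x)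
      = - (4 * real d * defect x * ((?N + (x \<bullet> x - a \<bullet> a)) * inv_dist_pow a (Suc d) x
          + defect x * inv_dist_pow a (Suc d) x))"
      by (simp add: algebra_simps power2_eq_square)
    also have "\<dots> = - (4 * real d * defect x * (?N * inv_dist_pow a (Suc d) x
          + (1 - a \<bullet> a) * inv_dist_pow a (Suc d) x))"
      by (simp add: defect_def algebra_simps)
    also have "\<dots> = 4 * real d * (a \<bullet> a - 1) * defect x * inv_dist_pow a (Suc d) x
        - 4 * real d * defect x * inv_dist_pow a d x"
      unfolding inv_dist_pow_Suc[OF x] by (simp add: algebra_simps)
    finally have S3: "(\<Sum>b\<in>Basis. 4 * defect x * (x \<bullet> b) * K1 b x - (defect x)\<^sup>2 * K2 b x)
      = 4 * real d * (a \<bullet> a - 1) * defect x * inv_dist_pow a (Suc d) x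
        - 4 * real d * defect x * inv_dist_pow a d x"
      unfolding S1[symmetric] S2[symmetric] by (simp add: sum_subtractf sum_distrib_left sum_distrib_right mult_ac)
    have "(\<Sum>b\<in>Basis. g b x) = ((defect x)\<^sup>2 * inv_dist_pow a d x) *\<^sub>R (\<Sum>b\<in>Basis. w2 b x)
      - (defect x * inv_dist_pow a d x) *\<^sub>R (\<Sum>b\<in>Basis. (4 * (x \<bullet> b)) *\<^sub>R w1 b x)
      + (\<Sum>b\<in>Basis. (4 * defect x * (x \<bullet> b) * K1 b x - (defect x)\<^sup>2 * K2 b x) *\<^sub>R w x)"
      unfolding g_def
      by (simp add: sum.distrib sum_subtractf scaleR_sum_right mult_ac)
    then show ?thesis
      unfolding scaleR_sum_left[symmetric] S3 by (simp add: green_op_def algebra_simps power2_eq_square)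
  qed
  have "(LINT x:ball 0 1|lborel. (\<Sum>b\<in>Basis. g b x)) = 0"
    using set_integral_sum[of Basis lborel "ball 0 1" g] zero continuous_imp_set_integrable_unit_ball[OF cg]
    by simp
  moreover have "(LINT x:ball 0 1|lborel. (\<Sum>b\<in>Basis. g b x)) =
     (LINT x:ball 0 1|lborel. (4 * real d * (a \<bullet> a - 1) * defect x * inv_dist_pow a (Suc d) x) *\<^sub>R w x
      - (defect x * inv_dist_pow a d x) *\<^sub>R green_op d w1 w2 w x)"
    by (rule set_lebesgue_integral_cong) (auto simp: sumg)
  moreover have "\<dots> = (LINT x:ball 0 1|lborel. (4 * real d * (a \<bullet> a - 1) * defect x * inv_dist_pow a (Suc d) x) *\<^sub>R w x)
      - (LINT x:ball 0 1|lborel. (defect x * inv_dist_pow a d x) *\<^sub>R green_op d w1 w2 w x)"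
    unfolding green_op_def using xa
    by (intro set_integral_diff continuous_imp_set_integrable_unit_ball continuous_intros cont) auto
  ultimately show ?thesis
    by simp
qed

text \<open>The pole \<open>a\<close> has distance \<open>e\<close> from \<open>\<zeta>\<close> and
  at least \<open>e\<close> from every point of the ball. The triangle inequality through
  \<open>a\<close> therefore costs a factor 2, which becomes \<open>4 ^ d\<close> in the power
  \<open>- 2 d\<close>.\<close>

lemma inv_dist_pow_dilate_le:
  assumes "norm \<zeta> = 1" "norm x < 1" "0 < e"
  defines "a \<equiv> (1 + e) *\<^sub>R \<zeta>"
  shows "e \<le> norm (x - a)" "norm (x - \<zeta>) \<le> 2 * norm (x - a)"
    "inv_dist_pow a d x \<le> 4 ^ d * inv_dist_pow \<zeta> d x"
proof -
  have na: "norm a = 1 + e"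
    using assms by (simp add: a_def)
  have az: "norm (a - \<zeta>) = e"
    using assms by (simp add: a_def algebra_simps)
  show 1: "e \<le> norm (x - a)"
    using norm_triangle_ineq3[of x a] na assms by linarith
  have "norm (x - \<zeta>) \<le> norm (x - a) + norm (a - \<zeta>)"
    using norm_triangle_ineq[of "x - a" "a - \<zeta>"] by simp
  then show 2: "norm (x - \<zeta>) \<le> 2 * norm (x - a)"
    using 1 az by simp
  have "norm (x - \<zeta>) > 0" "norm (x - a) > 0"
    using assms 1 by auto
  then have "inverse (norm (x - a)) \<le> 2 * inverse (norm (x - \<zeta>))"
    using 2 by (simp add: field_simps)
  then have "inverse (norm (x - a)) ^ (2 * d) \<le> (2 * inverse (norm (x - \<zeta>))) ^ (2 * d)"
    by (intro power_mono) auto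
  then show "inv_dist_pow a d x \<le> 4 ^ d * inv_dist_pow \<zeta> d x"
    by (simp add: inv_dist_pow_def power_mult power_mult_distrib power_inverse dot_square_norm)
qed

text \<open>In \<open>green_identity\<close> with \<open>a = (1 + e) \<zeta>\<close> both integrands are dominated by the Poisson kernel
  uniformly in \<open>e\<close>, since \<open>e \<le> |x - a|\<close> and \<open>|w x| \<le> 2 L |x - a|\<close>; the right one tends to 0.\<close>

lemma integral_poisson_green_op_eq_0:
  fixes w :: "'a::euclidean_space \<Rightarrow> 'b::euclidean_space"
  assumes dim: "DIM('a) = 2 * d" and z: "norm \<zeta> = 1"
    and c0: "continuous_on UNIV w"
    and c1: "\<And>b. b \<in> Basis \<Longrightarrow> continuous_on UNIV (w1 b)"
    and c2: "\<And>b. b \<in> Basis \<Longrightarrow> continuous_on UNIV (w2 b)"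
    and d1: "\<And>b x. b \<in> Basis \<Longrightarrow> ((\<lambda>t. w (x + t *\<^sub>R b)) has_vector_derivative w1 b x) (at 0)"
    and d2: "\<And>b x. b \<in> Basis \<Longrightarrow> ((\<lambda>t. w1 b (x + t *\<^sub>R b)) has_vector_derivative w2 b x) (at 0)"
    and L: "\<And>x. norm x < 1 \<Longrightarrow> norm (w x) \<le> L * norm (x - \<zeta>)"
    and int: "set_integrable lborel (ball 0 1) (\<lambda>x. defect x * inv_dist_pow \<zeta> d x)"
  shows "(LINT x:ball 0 1|lborel. (defect x * inv_dist_pow \<zeta> d x) *\<^sub>R green_op d w1 w2 w x) = 0"
proof -
  note cont = c0[THEN continuous_on_subset] c1[THEN continuous_on_subset] c2[THEN continuous_on_subset]
  have L0: "0 \<le> L"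
    using order_trans[OF norm_ge_zero L[of 0]] z by simp
  have cG: "continuous_on S (green_op d w1 w2 w)" for S
    unfolding green_op_def[abs_def] by (intro continuous_intros cont) auto
  obtain C where C: "norm (green_op d w1 w2 w x) \<le> C" if "norm x \<le> 1" for x
    using compact_imp_bounded[OF compact_continuous_image[OF cG compact_cball]]
    unfolding bounded_iff by (metis imageI mem_cball_0)
  have C0: "0 \<le> C"
    using order_trans[OF norm_ge_zero C[of 0]] by simp
  define e where "e n = 1 / real (Suc n)" for n
  define a where "a n = (1 + e n) *\<^sub>R \<zeta>" for n
  have e: "0 < e n" "e n \<le> 1" for n
    by (auto simp: e_def)
  have e_lim: "e \<longlonglongrightarrow> 0"
    using LIMSEQ_inverse_real_of_nat by (simp add: e_def[abs_def] inverse_eq_divide)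
  have na: "norm (a n) = 1 + e n" for n
    using z e[of n] by (simp add: a_def)
  have aa: "a n \<bullet> a n - 1 = 2 * e n + e n * e n" for n
    using z by (simp add: a_def norm_eq_1 algebra_simps)
  \<comment> \<open>The difference of the two integrands of \<open>green_identity\<close> for the
    pole \<open>a n\<close>: its integral is 0 for every \<open>n\<close>, so a single dominated
    limit is enough.\<close>
  define s where "s n x = (defect x * inv_dist_pow (a n) d x) *\<^sub>R green_op d w1 w2 w x
      - (4 * real d * (a n \<bullet> a n - 1) * defect x * inv_dist_pow (a n) (Suc d) x) *\<^sub>R w x" for n x
  have xa: "x \<noteq> a n" if "norm x \<le> 1" for x n
    using na[of n] e[of n] that by auto
  have cs: "continuous_on (cball 0 1) (s n)" for n
    unfolding s_def[abs_def] using xa by (intro continuous_intros cont cG) auto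
  have s0: "(LINT x:ball 0 1|lborel. s n x) = 0" for n
  proof -
    have "(LINT x:ball 0 1|lborel. s n x) =
       (LINT x:ball 0 1|lborel. (defect x * inv_dist_pow (a n) d x) *\<^sub>R green_op d w1 w2 w x)
       - (LINT x:ball 0 1|lborel. (4 * real d * (a n \<bullet> a n - 1) * defect x * inv_dist_pow (a n) (Suc d) x) *\<^sub>R w x)"
      unfolding s_def using xa
      by (intro set_integral_diff continuous_imp_set_integrable_unit_ball continuous_intros cont cG) auto
    moreover have "1 < norm (a n)"
      using na[of n] e[of n] by simp
    ultimately show ?thesis
      using green_identity[OF dim _ c0 c1 c2 d1 d2, of "a n"] by simp
  qed
  have bound: "norm (s n x) \<le> (defect x * inv_dist_pow \<zeta> d x) * (4 ^ d * (C + 24 * real d * L))"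
    if x: "norm x < 1" for n x
  proof -
    let ?r = "norm (x - a n)"
    have r: "e n \<le> ?r" "norm (x - \<zeta>) \<le> 2 * ?r"
      "inv_dist_pow (a n) d x \<le> 4 ^ d * inv_dist_pow \<zeta> d x"
      unfolding a_def using inv_dist_pow_dilate_le[OF z x e(1)[of n]] by auto
    have r0: "?r > 0"
      using r(1) e(1)[of n] by linarith
    have def0: "0 \<le> defect x"
      using x by (simp add: defect_def dot_square_norm power_le_one)
    \<comment> \<open>One factor \<open>?r\<close> comes from \<open>e n \<le> ?r\<close> and
      \<open>e n \<le> 1\<close>, the other from the assumption \<open>L\<close> on
      \<open>w\<close>. Together they cancel the surplus power in
      \<open>inv_dist_pow (a n) (Suc d)\<close>.\<close>
    have "(2 * e n + e n * e n) * norm (w x) \<le> (3 * ?r) * (L * (2 * ?r))"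
    proof (intro mult_mono)
      show "2 * e n + e n * e n \<le> 3 * ?r"
        using r(1) e[of n] mult_left_mono[of "e n" 1 "e n"] by linarith
      show "norm (w x) \<le> L * (2 * ?r)"
        using order_trans[OF L[OF x] mult_left_mono[OF r(2) L0]] .
    qed auto
    also have "\<dots> = 6 * L * ((x - a n) \<bullet> (x - a n))"
      by (simp add: dot_square_norm power2_eq_square)
    finally have w: "(2 * e n + e n * e n) * norm (w x) * inverse ((x - a n) \<bullet> (x - a n)) \<le> 6 * L"
      using r0 by (simp add: field_simps)
    have "norm (s n x) \<le> (defect x * inv_dist_pow (a n) d x) * norm (green_op d w1 w2 w x)
       + (4 * real d * (2 * e n + e n * e n) * defect x * inv_dist_pow (a n) (Suc d) x) * norm (w x)"
      unfolding s_def aa using def0 e[of n]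
      by (intro order_trans[OF norm_triangle_ineq4]) (simp add: abs_mult)
    also have "\<dots> = (defect x * inv_dist_pow (a n) d x) * (norm (green_op d w1 w2 w x)
       + 4 * real d * ((2 * e n + e n * e n) * norm (w x) * inverse ((x - a n) \<bullet> (x - a n))))"
      by (simp add: inv_dist_pow_def algebra_simps)
    also have "\<dots> \<le> (defect x * (4 ^ d * inv_dist_pow \<zeta> d x)) * (C + 4 * real d * (6 * L))"
    proof (rule mult_mono)
      show "norm (green_op d w1 w2 w x)
          + 4 * real d * ((2 * e n + e n * e n) * norm (w x) * inverse ((x - a n) \<bullet> (x - a n)))
        \<le> C + 4 * real d * (6 * L)"
        using C[of x] x by (intro add_mono mult_left_mono[OF w]) auto
      show "0 \<le> norm (green_op d w1 w2 w x)
          + 4 * real d * ((2 * e n + e n * e n) * norm (w x) * inverse ((x - a n) \<bullet> (x - a n)))"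
        using e(1)[of n] by (intro add_nonneg_nonneg mult_nonneg_nonneg) auto
    qed (use def0 r(3) in \<open>auto intro!: mult_left_mono\<close>)
    finally show ?thesis
      by (simp add: mult_ac)
  qed
  have "(\<lambda>n. LINT x|lborel. indicator (ball 0 1) x *\<^sub>R s n x) \<longlonglongrightarrow>
     (LINT x|lborel. indicator (ball 0 1) x *\<^sub>R ((defect x * inv_dist_pow \<zeta> d x) *\<^sub>R green_op d w1 w2 w x))"
  proof (rule integral_dominated_convergence[where
        w = "\<lambda>x. (indicator (ball 0 1) x *\<^sub>R (defect x * inv_dist_pow \<zeta> d x)) * (4 ^ d * (C + 24 * real d * L))"])
    show "(\<lambda>x. indicator (ball 0 1) x *\<^sub>R ((defect x * inv_dist_pow \<zeta> d x) *\<^sub>R green_op d w1 w2 w x)) \<in> borel_measurable lborel"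
    proof -
      have "continuous_on (ball 0 1) (\<lambda>x. (defect x * inv_dist_pow \<zeta> d x) *\<^sub>R green_op d w1 w2 w x)"
        using z by (intro continuous_intros cG) auto
      from borel_measurable_continuous_on_indicator[OF _ this] show ?thesis
        by (simp del: scaleR_scaleR)
    qed
    show "(\<lambda>x. indicator (ball 0 1) x *\<^sub>R s n x) \<in> borel_measurable lborel" for n
      using borel_measurable_continuous_on_indicator[of "ball 0 1" "s n"] continuous_on_subset[OF cs[of n], of "ball 0 1"]
      by auto
    show "integrable lborel (\<lambda>x. (indicator (ball 0 1) x *\<^sub>R (defect x * inv_dist_pow \<zeta> d x)) * (4 ^ d * (C + 24 * real d * L)))"
      using int unfolding set_integrable_def by (rule integrable_mult_left)
    show "AE x in lborel. norm (indicator (ball 0 1) x *\<^sub>R s n x)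
        \<le> (indicator (ball 0 1) x *\<^sub>R (defect x * inv_dist_pow \<zeta> d x)) * (4 ^ d * (C + 24 * real d * L))" for n
      using bound by (intro AE_I2) (auto simp: indicator_def)
    show "AE x in lborel. (\<lambda>n. indicator (ball 0 1) x *\<^sub>R s n x) \<longlonglongrightarrow>
        indicator (ball 0 1) x *\<^sub>R ((defect x * inv_dist_pow \<zeta> d x) *\<^sub>R green_op d w1 w2 w x)"
    proof (rule AE_I2)
      fix x :: 'a
      show "(\<lambda>n. indicator (ball 0 1) x *\<^sub>R s n x) \<longlonglongrightarrow>
        indicator (ball 0 1) x *\<^sub>R ((defect x * inv_dist_pow \<zeta> d x) *\<^sub>R green_op d w1 w2 w x)"
      proof (cases "norm x < 1")
        case True
        then have "x \<noteq> \<zeta>"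
          using z by auto
        have al: "a \<longlonglongrightarrow> \<zeta>"
          unfolding a_def[abs_def] by (rule tendsto_eq_intros e_lim refl | simp)+
        have "(\<lambda>n. inv_dist_pow (a n) m x) \<longlonglongrightarrow> inv_dist_pow \<zeta> m x" for m
          unfolding inv_dist_pow_def using \<open>x \<noteq> \<zeta>\<close> by (intro tendsto_intros al) auto
        moreover have "(\<lambda>n. a n \<bullet> a n - 1) \<longlonglongrightarrow> \<zeta> \<bullet> \<zeta> - 1"
          by (intro tendsto_intros al)
        \<comment> \<open>The second term of this limit is zero because
          \<open>\<zeta> \<bullet> \<zeta> = 1\<close>.\<close>
        ultimately have "(\<lambda>n. s n x) \<longlonglongrightarrow> (defect x * inv_dist_pow \<zeta> d x) *\<^sub>R green_op d w1 w2 w x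
           - (4 * real d * (\<zeta> \<bullet> \<zeta> - 1) * defect x * inv_dist_pow \<zeta> (Suc d) x) *\<^sub>R w x"
          unfolding s_def by (intro tendsto_diff tendsto_scaleR tendsto_mult tendsto_inner tendsto_const al)
        then show ?thesis
          using z True by (simp add: norm_eq_1)
      qed simp
    qed
  qed
  then show ?thesis
    using s0 unfolding set_lebesgue_integral_def by (simp add: LIMSEQ_const_iff)
qed

section \<open>Total mass of the Poisson kernel\<close>

text \<open>The derivative of \<open>defect x * inv_dist_pow \<zeta> d x\<close> along
  \<open>b\<close>. Any vector \<open>b\<close> is allowed, so that \<open>b = x\<close> gives the
  radial derivative; \<open>poisson_d2\<close> differentiates once more along the same
  \<open>b\<close>.\<close>

definition poisson_d1 :: "nat \<Rightarrow> 'a::real_inner \<Rightarrow> 'a \<Rightarrow> 'a \<Rightarrow> real" where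
  "poisson_d1 d \<zeta> b x = - 2 * (x \<bullet> b) * inv_dist_pow \<zeta> d x
     - 2 * real d * defect x * ((x - \<zeta>) \<bullet> b) * inv_dist_pow \<zeta> (Suc d) x"

definition poisson_d2 :: "nat \<Rightarrow> 'a::real_inner \<Rightarrow> 'a \<Rightarrow> 'a \<Rightarrow> real" where
  "poisson_d2 d \<zeta> b x = - 2 * (b \<bullet> b) * inv_dist_pow \<zeta> d x
     + 8 * real d * (x \<bullet> b) * ((x - \<zeta>) \<bullet> b) * inv_dist_pow \<zeta> (Suc d) x
     - 2 * real d * defect x * (b \<bullet> b) * inv_dist_pow \<zeta> (Suc d) x
     + 4 * real d * real (Suc d) * defect x * ((x - \<zeta>) \<bullet> b)\<^sup>2 * inv_dist_pow \<zeta> (Suc (Suc d)) x"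

lemma poisson_line:
  assumes "x \<noteq> \<zeta>"
  shows "((\<lambda>t. defect (x + t *\<^sub>R b) * inv_dist_pow \<zeta> d (x + t *\<^sub>R b)) has_real_derivative
    poisson_d1 d \<zeta> b x) (at 0)"
  by (rule DERIV_cong[OF DERIV_mult[OF defect_line inv_dist_pow_line[OF assms]]])
    (simp add: poisson_d1_def algebra_simps)

lemma poisson_d1_line:
  assumes "x \<noteq> \<zeta>"
  shows "((\<lambda>t. poisson_d1 d \<zeta> b (x + t *\<^sub>R b)) has_real_derivative poisson_d2 d \<zeta> b x) (at 0)"
proof -
  have 1: "((\<lambda>t. - 2 * ((x + t *\<^sub>R b) \<bullet> b)) has_real_derivative - 2 * (b \<bullet> b)) (at 0)"
    using DERIV_cmult[OF inner_line[of x b 0 b], of "-2"] by simp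
  have 2: "((\<lambda>t. 2 * real d * defect (x + t *\<^sub>R b)) has_real_derivative 2 * real d * (- 2 * (x \<bullet> b))) (at 0)"
    by (rule DERIV_cmult[OF defect_line])
  show ?thesis
    unfolding poisson_d1_def
    by (rule DERIV_cong[OF DERIV_diff[OF DERIV_mult[OF 1 inv_dist_pow_line[OF assms]]
          DERIV_mult[OF DERIV_mult[OF 2 inner_line] inv_dist_pow_line[OF assms]]]])
      (simp add: poisson_d2_def power2_eq_square algebra_simps)
qed

text \<open>\<open>poisson_d1\<close> is linear in the direction, so summing over the expansion of
  \<open>y\<close> in the basis produces the derivative along \<open>y\<close>.\<close>

lemma sum_poisson_d1:
  fixes x :: "'a::euclidean_space"
  shows "(\<Sum>b\<in>Basis. (y \<bullet> b) * poisson_d1 d \<zeta> b x) = poisson_d1 d \<zeta> y x"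
proof -
  have "(\<Sum>b\<in>Basis. (y \<bullet> b) * poisson_d1 d \<zeta> b x) =
     - 2 * inv_dist_pow \<zeta> d x * (\<Sum>b\<in>Basis. (x \<bullet> b) * (y \<bullet> b))
     - 2 * real d * defect x * inv_dist_pow \<zeta> (Suc d) x * (\<Sum>b\<in>Basis. ((x - \<zeta>) \<bullet> b) * (y \<bullet> b))"
    unfolding poisson_d1_def sum_distrib_left sum_subtractf[symmetric]
    by (intro sum.cong) (auto simp: algebra_simps)
  then show ?thesis
    unfolding sum_Basis_inner_mult by (simp add: poisson_d1_def)
qed

text \<open>Harmonicity of the Poisson kernel. The summed terms cancel through \<open>2 (x \<bullet>
  (x - \<zeta>)) + 1 - |x|\<^sup>2 = |x - \<zeta>|\<^sup>2\<close>, which is where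
  \<open>norm \<zeta> = 1\<close> enters.\<close>

lemma sum_poisson_d2:
  fixes x :: "'a::euclidean_space"
  assumes dim: "DIM('a) = 2 * d" and "x \<noteq> \<zeta>" and z: "norm \<zeta> = 1"
  shows "(\<Sum>b\<in>Basis. poisson_d2 d \<zeta> b x) = 0"
proof -
  let ?N = "(x - \<zeta>) \<bullet> (x - \<zeta>)"
  have "(\<Sum>b\<in>Basis. poisson_d2 d \<zeta> b x) =
      (\<Sum>b\<in>(Basis::'a set). - 2 * inv_dist_pow \<zeta> d x - 2 * real d * defect x * inv_dist_pow \<zeta> (Suc d) x)
      + 8 * real d * inv_dist_pow \<zeta> (Suc d) x * (\<Sum>b\<in>Basis. (x \<bullet> b) * ((x - \<zeta>) \<bullet> b))
      + 4 * real d * real (Suc d) * defect x * inv_dist_pow \<zeta> (Suc (Suc d)) x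
         * (\<Sum>b\<in>Basis. ((x - \<zeta>) \<bullet> b) * ((x - \<zeta>) \<bullet> b))"
    unfolding poisson_d2_def sum_distrib_left sum.distrib[symmetric]
    by (intro sum.cong) (auto simp: power2_eq_square algebra_simps)
  also have "\<dots> = 2 * real d * (- 2 * inv_dist_pow \<zeta> d x - 2 * real d * defect x * inv_dist_pow \<zeta> (Suc d) x)
      + 8 * real d * inv_dist_pow \<zeta> (Suc d) x * (x \<bullet> (x - \<zeta>))
      + 4 * real d * real (Suc d) * defect x * (?N * inv_dist_pow \<zeta> (Suc (Suc d)) x)"
    unfolding sum_Basis_inner_mult by (simp add: dim mult_ac)
  also have "\<dots> = - 4 * real d * inv_dist_pow \<zeta> d x
      + 4 * real d * inv_dist_pow \<zeta> (Suc d) x * (2 * (x \<bullet> (x - \<zeta>)) + defect x)"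
    unfolding inv_dist_pow_Suc[OF assms(2)] by (simp add: algebra_simps)
  also have "2 * (x \<bullet> (x - \<zeta>)) + defect x = ?N"
    using z by (simp add: defect_def norm_eq_1 inner_simps inner_commute)
  also have "- 4 * real d * inv_dist_pow \<zeta> d x + 4 * real d * inv_dist_pow \<zeta> (Suc d) x * ?N
      = 4 * real d * (?N * inv_dist_pow \<zeta> (Suc d) x - inv_dist_pow \<zeta> d x)"
    by (simp add: algebra_simps)
  finally show ?thesis
    unfolding inv_dist_pow_Suc[OF assms(2)] by simp
qed

text \<open>For the harmonic function \<open>h = defect * inv_dist_pow \<zeta> d\<close>, the field \<open>(1 - |x|\<^sup>2) \<nabla>h(t x)\<close> vanishes on
  the sphere and has divergence \<open>- 2 x \<bullet> \<nabla>h(t x)\<close>.\<close>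

lemma integral_radial_deriv_poisson:
  fixes \<zeta> :: "'a::euclidean_space"
  assumes dim: "DIM('a) = 2 * d" and z: "norm \<zeta> = 1" and t: "0 \<le> t" "t < 1"
  shows "(LINT x:ball 0 1|lborel. poisson_d1 d \<zeta> x (t *\<^sub>R x)) = 0"
proof -
  have ne: "t *\<^sub>R x \<noteq> \<zeta>" if "norm x \<le> 1" for x
  proof -
    have "norm (t *\<^sub>R x) \<le> t"
      using that t by (simp add: mult_left_le)
    then have "norm (t *\<^sub>R x) \<noteq> norm \<zeta>"
      using z t by linarith
    then show ?thesis
      by metis
  qed
  \<comment> \<open>The derivative along \<open>b\<close> of the \<open>b\<close>-component of the
    field; the factor \<open>t\<close> is the inner derivative of
    \<open>t *\<^sub>R x\<close>.\<close>
  define g where "g b x = defect x * (poisson_d2 d \<zeta> b (t *\<^sub>R x) * t)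
      - 2 * (x \<bullet> b) * poisson_d1 d \<zeta> b (t *\<^sub>R x)" for b x
  have cg: "continuous_on (cball 0 1) (g b)" for b
    unfolding g_def poisson_d1_def poisson_d2_def
    using ne by (intro continuous_intros) auto
  have zero: "(LINT x:ball 0 1|lborel. g b x) = 0" if b: "b \<in> Basis" for b
  proof (rule integral_directional_deriv_ball)
    let ?f = "\<lambda>x. defect x * poisson_d1 d \<zeta> b (t *\<^sub>R x)"
    show "continuous_on (cball 0 1) ?f"
      unfolding poisson_d1_def using ne by (intro continuous_intros) auto
    show "continuous_on (cball 0 1) (g b)"
      by (rule cg)
    show "?f x = 0" if "norm x = 1" for x
      using that by (simp add: defect_def norm_eq_1)
    show "norm b = 1"
      using b by simp
    fix x :: 'a
    assume x: "norm x < 1"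
    have "((\<lambda>s. poisson_d1 d \<zeta> b (t *\<^sub>R x + s *\<^sub>R b)) has_real_derivative poisson_d2 d \<zeta> b (t *\<^sub>R x)) (at (t * 0))"
      using poisson_d1_line[of "t *\<^sub>R x" \<zeta>] ne[of x] x by simp
    moreover have "((\<lambda>s. t * s) has_real_derivative t) (at 0)"
      by (auto intro!: derivative_eq_intros)
    ultimately have "((\<lambda>s. poisson_d1 d \<zeta> b (t *\<^sub>R x + (t * s) *\<^sub>R b)) has_real_derivative
        poisson_d2 d \<zeta> b (t *\<^sub>R x) * t) (at 0)"
      by (rule DERIV_chain2)
    then have "((\<lambda>s. poisson_d1 d \<zeta> b (t *\<^sub>R (x + s *\<^sub>R b))) has_real_derivative
        poisson_d2 d \<zeta> b (t *\<^sub>R x) * t) (at 0)"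
      by (simp add: algebra_simps)
    from DERIV_mult[OF defect_line this]
    have "((\<lambda>s. ?f (x + s *\<^sub>R b)) has_real_derivative g b x) (at 0)"
      by (rule DERIV_cong) (simp add: g_def algebra_simps)
    then show "((\<lambda>s. ?f (x + s *\<^sub>R b)) has_vector_derivative g b x) (at 0)"
      by (simp add: has_real_derivative_iff_has_vector_derivative)
  qed
  have "(LINT x:ball 0 1|lborel. (\<Sum>b\<in>Basis. g b x)) = 0"
    using set_integral_sum[of Basis lborel "ball 0 1" g] zero continuous_imp_set_integrable_unit_ball[OF cg]
    by simp
  moreover have "(LINT x:ball 0 1|lborel. (\<Sum>b\<in>Basis. g b x)) =
     (LINT x:ball 0 1|lborel. - 2 * poisson_d1 d \<zeta> x (t *\<^sub>R x))"
  proof (rule set_lebesgue_integral_cong)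
    show "\<forall>x. x \<in> ball 0 1 \<longrightarrow> (\<Sum>b\<in>Basis. g b x) = - 2 * poisson_d1 d \<zeta> x (t *\<^sub>R x)"
    proof (intro allI impI)
      fix x :: 'a
      assume "x \<in> ball 0 1"
      then have "t *\<^sub>R x \<noteq> \<zeta>"
        using ne[of x] by simp
      have "(\<Sum>b\<in>Basis. g b x) = defect x * t * (\<Sum>b\<in>Basis. poisson_d2 d \<zeta> b (t *\<^sub>R x))
        - 2 * (\<Sum>b\<in>Basis. (x \<bullet> b) * poisson_d1 d \<zeta> b (t *\<^sub>R x))"
        unfolding g_def sum_distrib_left sum_subtractf[symmetric]
        by (intro sum.cong) (auto simp: mult_ac)
      then show "(\<Sum>b\<in>Basis. g b x) = - 2 * poisson_d1 d \<zeta> x (t *\<^sub>R x)"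
        unfolding sum_poisson_d1 sum_poisson_d2[OF dim \<open>t *\<^sub>R x \<noteq> \<zeta>\<close> z] by simp
    qed
  qed auto
  moreover have "\<dots> = - 2 * (LINT x:ball 0 1|lborel. poisson_d1 d \<zeta> x (t *\<^sub>R x))"
    unfolding set_lebesgue_integral_def
    by (subst Bochner_Integration.integral_mult_right_zero[symmetric]) (simp add: mult_ac)
  ultimately show ?thesis
    by simp
qed

text \<open>Along a ray, the change of the kernel from its value 1 at the origin is the integral
  over \<open>{0..t}\<close> of the radial derivative. Exchanging the two integrals by Fubini gives
  zero by \<open>integral_radial_deriv_poisson\<close>, without differentiation under the integral
  sign.\<close>

lemma integral_poisson_dilate:
  fixes \<zeta> :: "'a::euclidean_space"
  assumes dim: "DIM('a) = 2 * d" and z: "norm \<zeta> = 1" and t: "0 \<le> t" "t < 1"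
  shows "(LINT x:ball 0 1|lborel. defect (t *\<^sub>R x) * inv_dist_pow \<zeta> d (t *\<^sub>R x)) = measure lborel (ball (0::'a) 1)"
proof -
  have ne: "s *\<^sub>R x \<noteq> \<zeta>" if "norm x \<le> 1" "0 \<le> s" "s \<le> t" for x s
  proof -
    have "norm (s *\<^sub>R x) \<le> s"
      using that by (simp add: mult_left_le)
    then have "norm (s *\<^sub>R x) \<noteq> norm \<zeta>"
      using z t that by linarith
    then show ?thesis
      by metis
  qed
  let ?h = "\<lambda>x. defect x * inv_dist_pow \<zeta> d x"
  have h0: "?h 0 = 1"
    using z by (simp add: defect_def inv_dist_pow_def norm_eq_1)
  define F where "F x s = indicator (ball 0 1 \<times> {0..t}) (x, s) * poisson_d1 d \<zeta> x (s *\<^sub>R x)" for x s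
  have "set_integrable lborel (cball 0 1 \<times> {0..t}) (\<lambda>(x, s). poisson_d1 d \<zeta> x (s *\<^sub>R x))"
    unfolding set_integrable_def
  proof (rule borel_integrable_compact)
    have "snd p *\<^sub>R fst p \<noteq> \<zeta>" if "p \<in> cball 0 1 \<times> {0..t}" for p
      using ne[of "fst p" "snd p"] that by auto
    then show "continuous_on (cball 0 1 \<times> {0..t}) (\<lambda>(x, s). poisson_d1 d \<zeta> x (s *\<^sub>R x))"
      unfolding poisson_d1_def case_prod_unfold
      by (intro continuous_intros) simp_all
  qed (intro compact_Times compact_cball compact_Icc)
  then have "set_integrable lborel (ball 0 1 \<times> {0..t}) (\<lambda>(x, s). poisson_d1 d \<zeta> x (s *\<^sub>R x))"
  proof (rule set_integrable_subset)
    show "ball 0 1 \<times> {0..t} \<in> sets (lborel :: ('a \<times> real) measure)"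
      by (simp add: borel_Times)
  qed auto
  then have "integrable lborel (case_prod F)"
    unfolding set_integrable_def F_def[abs_def] by (simp add: case_prod_unfold)
  then have intF: "integrable (lborel \<Otimes>\<^sub>M lborel) (case_prod F)"
    by (simp only: lborel_prod)
  have "(LINT x|lborel. LINT s|lborel. F x s) = (LINT s|lborel. LINT x|lborel. F x s)"
    using lborel_pair.Fubini_integral[OF intF] by simp
  also have "\<dots> = 0"
  proof -
    have "(LINT x|lborel. F x s) = indicator {0..t} s * (LINT x:ball 0 1|lborel. poisson_d1 d \<zeta> x (s *\<^sub>R x))" for s
      unfolding set_lebesgue_integral_def F_def
      by (auto simp: indicator_def intro!: Bochner_Integration.integral_cong)
    also have "\<dots> s = 0" for s
      using integral_radial_deriv_poisson[OF dim z, of s] t by (auto simp: indicator_def)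
    finally show ?thesis
      by simp
  qed
  also have "(LINT x|lborel. LINT s|lborel. F x s) =
      (LINT x:ball 0 1|lborel. ?h (t *\<^sub>R x) - 1)"
    unfolding set_lebesgue_integral_def
  proof (rule Bochner_Integration.integral_cong[OF refl])
    fix x :: 'a
    show "(LINT s|lborel. F x s) = indicator (ball 0 1) x *\<^sub>R (?h (t *\<^sub>R x) - 1)"
    proof (cases "norm x < 1")
      case True
      have "(LINT s|lborel. F x s) = (LINT s|lborel. indicator {0..t} s *\<^sub>R poisson_d1 d \<zeta> x (s *\<^sub>R x))"
        using True by (intro Bochner_Integration.integral_cong) (auto simp: F_def indicator_def)
      also have "\<dots> = ?h (t *\<^sub>R x) - ?h (0 *\<^sub>R x)"
      proof (rule integral_FTC_Icc)
        show "continuous_on {0..t} (\<lambda>s. poisson_d1 d \<zeta> x (s *\<^sub>R x))"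
          unfolding poisson_d1_def using ne[of x] True by (intro continuous_intros) auto
        fix s assume s: "0 \<le> s" "s \<le> t"
        \<comment> \<open>Writing the base point as \<open>s - s\<close> prepares a chain rule with
          \<open>r - s\<close>, which moves \<open>poisson_line\<close> from parameter 0 to
          parameter \<open>s\<close>.\<close>
        have "((\<lambda>r. ?h (s *\<^sub>R x + r *\<^sub>R x)) has_real_derivative poisson_d1 d \<zeta> x (s *\<^sub>R x)) (at (s - s))"
          using poisson_line[OF ne[of x s]] s True by simp
        moreover have "((\<lambda>r. r - s) has_real_derivative 1) (at s)"
          by (auto intro!: derivative_eq_intros)
        ultimately have "((\<lambda>r. ?h (s *\<^sub>R x + (r - s) *\<^sub>R x)) has_real_derivative poisson_d1 d \<zeta> x (s *\<^sub>R x) * 1) (at s)"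
          by (rule DERIV_chain2)
        then show "((\<lambda>s. ?h (s *\<^sub>R x)) has_vector_derivative poisson_d1 d \<zeta> x (s *\<^sub>R x)) (at s within {0..t})"
          by (simp add: has_real_derivative_iff_has_vector_derivative[symmetric] algebra_simps
              has_field_derivative_at_within)
      qed (use t in auto)
      finally show ?thesis
        using True h0 by simp
    qed (simp add: F_def)
  qed
  also have "\<dots> = (LINT x:ball 0 1|lborel. ?h (t *\<^sub>R x)) - (LINT x:ball (0::'a) 1|lborel. 1)"
    using ne t by (intro set_integral_diff continuous_imp_set_integrable_unit_ball continuous_intros) auto
  finally show ?thesis
    by (simp add: set_lebesgue_integral_def)
qed

lemma nn_integral_lborel_scale:
  fixes f :: "'a::euclidean_space \<Rightarrow> ennreal"
  assumes [measurable]: "f \<in> borel_measurable borel" and c: "0 < c"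
  shows "(\<integral>\<^sup>+x. f x \<partial>lborel) = ennreal (c ^ DIM('a)) * (\<integral>\<^sup>+x. f (c *\<^sub>R x) \<partial>lborel)"
  by (subst lborel_affine[of c 0]) (use c in \<open>simp_all add: nn_integral_density nn_integral_distr nn_integral_cmult\<close>)

lemma poisson_nonneg: "norm x \<le> 1 \<Longrightarrow> 0 \<le> defect x * inv_dist_pow \<zeta> d x"
  by (simp add: defect_def dot_square_norm power_le_one)

text \<open>Rescaling turns the dilated kernel on the unit ball into the kernel itself on
  \<open>ball 0 t\<close>. With nonnegative integrals, the passage to radius 1 needs no prior
  integrability.\<close>

lemma nn_integral_poisson_ball:
  fixes \<zeta> :: "'a::euclidean_space"
  assumes dim: "DIM('a) = 2 * d" and z: "norm \<zeta> = 1" and t: "0 < t" "t < 1"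
  shows "(\<integral>\<^sup>+x. ennreal (indicator (ball 0 t) x * (defect x * inv_dist_pow \<zeta> d x)) \<partial>lborel)
       = ennreal (t ^ DIM('a)) * emeasure lborel (ball (0::'a) 1)"
proof -
  let ?h = "\<lambda>x. defect x * inv_dist_pow \<zeta> d x"
  have ne: "t *\<^sub>R x \<noteq> \<zeta>" if "norm x \<le> 1" for x
  proof -
    have "norm (t *\<^sub>R x) \<le> t"
      using that t by (simp add: mult_left_le)
    then have "norm (t *\<^sub>R x) \<noteq> norm \<zeta>"
      using z t by linarith
    then show ?thesis
      by metis
  qed
  have "continuous_on (ball 0 t) ?h"
    using t z by (intro continuous_intros) auto
  from borel_measurable_continuous_on_indicator[OF _ this]
  have meas: "(\<lambda>x. indicator (ball 0 t) x * ?h x) \<in> borel_measurable borel"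
    by simp
  have ind: "indicator (ball 0 t) (t *\<^sub>R x) = (indicator (ball 0 1) x :: real)" for x :: 'a
    using t by (simp add: indicator_def)
  have "set_integrable lborel (ball 0 1) (\<lambda>x. ?h (t *\<^sub>R x))"
    using ne by (intro continuous_imp_set_integrable_unit_ball continuous_intros) auto
  then have "(\<integral>\<^sup>+x. ennreal (indicator (ball 0 1) x * ?h (t *\<^sub>R x)) \<partial>lborel)
      = ennreal (LINT x:ball 0 1|lborel. ?h (t *\<^sub>R x))"
    unfolding set_integrable_def set_lebesgue_integral_def real_scaleR_def
  proof (rule nn_integral_eq_integral)
    show "AE x in lborel. 0 \<le> indicator (ball 0 1) x * ?h (t *\<^sub>R x)"
      using t by (intro AE_I2) (auto simp: indicator_def intro!: poisson_nonneg mult_le_one)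
  qed
  also have "\<dots> = ennreal (measure lborel (ball (0::'a) 1))"
    using integral_poisson_dilate[OF dim z, of t] t by simp
  also have "\<dots> = emeasure lborel (ball (0::'a) 1)"
    using emeasure_bounded_finite[of "ball (0::'a) 1"] by (intro emeasure_eq_ennreal_measure[symmetric]) auto
  finally show ?thesis
    using nn_integral_lborel_scale[OF measurable_compose[OF meas measurable_ennreal] t(1)] ind by simp
qed

text \<open>Monotone convergence over balls with radii increasing to 1, the kernel being
  nonnegative.\<close>

lemma nn_integral_poisson:
  fixes \<zeta> :: "'a::euclidean_space"
  assumes dim: "DIM('a) = 2 * d" and z: "norm \<zeta> = 1"
  shows "(\<integral>\<^sup>+x. ennreal (indicator (ball 0 1) x * (defect x * inv_dist_pow \<zeta> d x)) \<partial>lborel)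
       = emeasure lborel (ball (0::'a) 1)"
proof -
  let ?h = "\<lambda>x. defect x * inv_dist_pow \<zeta> d x"
  \<comment> \<open>The radii start at \<open>1/2\<close>, so each is strictly positive, as the
    rescaling requires.\<close>
  define t where "t n = 1 - inverse (real (Suc (Suc n)))" for n
  have t: "0 < t n" "t n < 1" for n
    by (auto simp: t_def inverse_eq_divide)
  have t_mono: "t m \<le> t n" if "m \<le> n" for m n
    using that by (auto simp: t_def intro!: le_imp_inverse_le)
  have t_lim: "t \<longlonglongrightarrow> 1"
    unfolding t_def[abs_def]
    using tendsto_diff[OF tendsto_const[of 1] LIMSEQ_Suc[OF LIMSEQ_inverse_real_of_nat]] by simp
  define f where "f n x = ennreal (indicator (ball 0 (t n)) x * ?h x)" for n x
  have cont: "continuous_on (ball 0 (t n)) ?h" for n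
    using t[of n] z by (intro continuous_intros) auto
  have meas: "f n \<in> borel_measurable lborel" for n
    using borel_measurable_continuous_on_indicator[OF _ cont[of n]] unfolding f_def by simp
  have "f m x \<le> f n x" if "m \<le> n" for m n x
    using t_mono[OF that] t[of n] poisson_nonneg[of x \<zeta> d] by (auto simp: f_def indicator_def)
  then have inc: "incseq f"
    by (auto simp: incseq_def le_fun_def)
  have lim: "(\<lambda>n. f n x) \<longlonglongrightarrow> ennreal (indicator (ball 0 1) x * ?h x)" for x
  proof (cases "norm x < 1")
    case True
    have "eventually (\<lambda>n. norm x < t n) sequentially"
      by (rule order_tendstoD(1)[OF t_lim True])
    then show ?thesis
      using True by (intro tendsto_eventually) (auto simp: f_def elim!: eventually_mono)
  next
    case False
    then have "\<not> norm x < t n" for n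
      using t(2)[of n] by linarith
    then show ?thesis
      using False by (simp add: f_def)
  qed
  have "(\<lambda>n. integral\<^sup>N lborel (f n)) \<longlonglongrightarrow>
      (\<integral>\<^sup>+x. ennreal (indicator (ball 0 1) x * ?h x) \<partial>lborel)"
    by (rule nn_integral_LIMSEQ[OF inc meas lim])
  moreover have "(\<lambda>n. integral\<^sup>N lborel (f n)) \<longlonglongrightarrow> ennreal (1 ^ DIM('a)) * emeasure lborel (ball (0::'a) 1)"
    unfolding f_def nn_integral_poisson_ball[OF dim z t]
    using emeasure_bounded_finite[of "ball (0::'a) 1"]
    by (intro tendsto_mult_ennreal tendsto_const tendsto_ennrealI tendsto_power t_lim) auto
  ultimately show ?thesis
    using LIMSEQ_unique by fastforce
qed

text \<open>Finiteness of the nonnegative integral supplies the integrability that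
  \<open>integral_poisson_green_op_eq_0\<close> assumes.\<close>

lemma
  fixes \<zeta> :: "'a::euclidean_space"
  assumes dim: "DIM('a) = 2 * d" and z: "norm \<zeta> = 1"
  shows set_integrable_poisson: "set_integrable lborel (ball 0 1) (\<lambda>x. defect x * inv_dist_pow \<zeta> d x)"
    and integral_poisson: "(LINT x:ball 0 1|lborel. defect x * inv_dist_pow \<zeta> d x) = measure lborel (ball (0::'a) 1)"
proof -
  let ?h = "\<lambda>x. indicator (ball 0 1) x * (defect x * inv_dist_pow \<zeta> d x)"
  have "continuous_on (ball 0 1) (\<lambda>x. defect x * inv_dist_pow \<zeta> d x)"
    using z by (intro continuous_intros) auto
  from borel_measurable_continuous_on_indicator[OF _ this]
  have meas: "?h \<in> borel_measurable lborel"
    by simp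
  have nonneg: "AE x in lborel. 0 \<le> ?h x"
    by (intro AE_I2) (auto simp: indicator_def intro!: poisson_nonneg)
  have fin: "emeasure lborel (ball (0::'a) 1) < \<infinity>"
    by (intro emeasure_bounded_finite) auto
  have "integrable lborel ?h"
    using nn_integral_poisson[OF dim z] fin meas nonneg by (intro integrableI_nonneg) auto
  then show "set_integrable lborel (ball 0 1) (\<lambda>x. defect x * inv_dist_pow \<zeta> d x)"
    by (simp add: set_integrable_def)
  show "(LINT x:ball 0 1|lborel. defect x * inv_dist_pow \<zeta> d x) = measure lborel (ball (0::'a) 1)"
    using integral_eq_nn_integral[OF meas nonneg] nn_integral_poisson[OF dim z]
    by (simp add: set_lebesgue_integral_def measure_def)
qed

section \<open>Holomorphic polynomials\<close>

text \<open>Polynomial functions are generated by arithmetic rather than by coefficients, so that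
  Lipschitz bounds and derivatives follow by rule induction.\<close>

inductive_set holo_poly :: "(complex ^ ('n::finite) \<Rightarrow> complex) set" where
  const: "(\<lambda>z. c) \<in> holo_poly"
| coord: "(\<lambda>z. z $ j) \<in> holo_poly"
| add: "f \<in> holo_poly \<Longrightarrow> g \<in> holo_poly \<Longrightarrow> (\<lambda>z. f z + g z) \<in> holo_poly"
| mult: "f \<in> holo_poly \<Longrightarrow> g \<in> holo_poly \<Longrightarrow> (\<lambda>z. f z * g z) \<in> holo_poly"

lemma holo_poly_sum:
  "(\<And>i. i \<in> I \<Longrightarrow> f i \<in> holo_poly) \<Longrightarrow> (\<lambda>z. \<Sum>i\<in>I. f i z) \<in> holo_poly"
  by (induction I rule: infinite_finite_induct) (auto intro: holo_poly.intros)

lemma holo_poly_prod: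
  "(\<And>i. i \<in> I \<Longrightarrow> f i \<in> holo_poly) \<Longrightarrow> (\<lambda>z. \<Prod>i\<in>I. f i z) \<in> holo_poly"
  by (induction I rule: infinite_finite_induct) (auto intro: holo_poly.intros)

lemma holo_poly_power: "f \<in> holo_poly \<Longrightarrow> (\<lambda>z. f z ^ m) \<in> holo_poly"
  by (induction m) (auto intro: holo_poly.intros)

lemma continuous_on_holo_poly: "f \<in> holo_poly \<Longrightarrow> continuous_on S f"
  by (induction rule: holo_poly.induct) (auto intro!: continuous_intros)

text \<open>Meant for the assumption \<open>L\<close> of
  \<open>integral_poisson_green_op_eq_0\<close>. One fixed point \<open>\<zeta>\<close> suffices
  there, and the constant is built up along the construction of \<open>f\<close>.\<close>

lemma holo_poly_Lipschitz:
  assumes "f \<in> holo_poly" "norm \<zeta> \<le> 1"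
  shows "\<exists>L\<ge>0. \<forall>x. norm x \<le> 1 \<longrightarrow> norm (f x - f \<zeta>) \<le> L * norm (x - \<zeta>)"
  using assms(1)
proof induction
  case (const c)
  then show ?case by auto
next
  case (coord j)
  show ?case
    using Finite_Cartesian_Product.norm_nth_le[of "x - \<zeta>" j for x]
    by (intro exI[of _ 1]) simp
next
  case (add f g)
  then obtain L M where "L \<ge> 0" "M \<ge> 0"
    and LM: "\<And>x. norm x \<le> 1 \<Longrightarrow> norm (f x - f \<zeta>) \<le> L * norm (x - \<zeta>)"
      "\<And>x. norm x \<le> 1 \<Longrightarrow> norm (g x - g \<zeta>) \<le> M * norm (x - \<zeta>)"
    by auto
  show ?case
  proof (intro exI[of _ "L + M"] conjI allI impI)
    fix x :: "complex ^ 'a"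
    assume "norm x \<le> 1"
    have "norm (f x + g x - (f \<zeta> + g \<zeta>)) \<le> norm (f x - f \<zeta>) + norm (g x - g \<zeta>)"
      by (metis add_diff_add norm_triangle_ineq)
    then show "norm (f x + g x - (f \<zeta> + g \<zeta>)) \<le> (L + M) * norm (x - \<zeta>)"
      using LM[OF \<open>norm x \<le> 1\<close>] by (simp add: algebra_simps)
  qed (use \<open>L \<ge> 0\<close> \<open>M \<ge> 0\<close> in auto)
next
  case (mult f g)
  then obtain L M where "L \<ge> 0" "M \<ge> 0"
    and LM: "\<And>x. norm x \<le> 1 \<Longrightarrow> norm (f x - f \<zeta>) \<le> L * norm (x - \<zeta>)"
      "\<And>x. norm x \<le> 1 \<Longrightarrow> norm (g x - g \<zeta>) \<le> M * norm (x - \<zeta>)"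
    by auto
  \<comment> \<open>The Lipschitz estimate itself bounds \<open>f\<close> on the ball, since two of
    its points have distance at most 2.\<close>
  have f: "norm (f x) \<le> norm (f \<zeta>) + 2 * L" if "norm x \<le> 1" for x
  proof -
    have "norm (x - \<zeta>) \<le> 2"
      using norm_triangle_ineq4[of x \<zeta>] that assms(2) by linarith
    then have "L * norm (x - \<zeta>) \<le> L * 2"
      using \<open>L \<ge> 0\<close> by (rule mult_left_mono)
    then show ?thesis
      using LM(1)[OF that] norm_triangle_ineq2[of "f x" "f \<zeta>"] by linarith
  qed
  show ?case
  proof (intro exI[of _ "(norm (f \<zeta>) + 2 * L) * M + norm (g \<zeta>) * L"] conjI allI impI)
    fix x :: "complex ^ 'a"
    assume x: "norm x \<le> 1"
    have "f x * g x - f \<zeta> * g \<zeta> = f x * (g x - g \<zeta>) + g \<zeta> * (f x - f \<zeta>)"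
      by (simp add: algebra_simps)
    then have "norm (f x * g x - f \<zeta> * g \<zeta>) \<le> norm (f x) * norm (g x - g \<zeta>) + norm (g \<zeta>) * norm (f x - f \<zeta>)"
      by (metis norm_mult norm_triangle_ineq)
    also have "\<dots> \<le> (norm (f \<zeta>) + 2 * L) * (M * norm (x - \<zeta>)) + norm (g \<zeta>) * (L * norm (x - \<zeta>))"
      using \<open>L \<ge> 0\<close> \<open>M \<ge> 0\<close> by (intro add_mono mult_mono f LM x) auto
    finally show "norm (f x * g x - f \<zeta> * g \<zeta>) \<le> ((norm (f \<zeta>) + 2 * L) * M + norm (g \<zeta>) * L) * norm (x - \<zeta>)"
      by (simp add: algebra_simps)
  qed (use \<open>L \<ge> 0\<close> \<open>M \<ge> 0\<close> in auto)
qed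

text \<open>The embedding \<open>axis j\<close> of a coordinate line is linear, so the chain rule
  identifies the partial derivative with the \<open>j\<close>-th coefficient of a complex-linear
  total derivative. This makes the calculus of total derivatives available for
  \<open>cgrad\<close>.\<close>

lemma cgrad_eqI:
  assumes "(f has_derivative (\<lambda>h. \<Sum>j\<in>UNIV. g j * h $ j)) (at z)"
  shows "cgrad f z $ j = g j"
proof -
  have line: "(\<chi> i. if i = j then w else z $ i) = z + axis j (w - z $ j)" for w
    by (auto simp: vec_eq_iff axis_def)
  have "linear (axis j :: complex \<Rightarrow> complex ^ 'a)"
    by (rule linearI) (auto simp: vec_eq_iff axis_def)
  then have bl: "bounded_linear (axis j :: complex \<Rightarrow> complex ^ 'a)"
    by (simp add: linear_conv_bounded_linear)
  have "((\<lambda>w. w - z $ j) has_derivative (\<lambda>h. h)) (at (z $ j))"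
    by (auto intro!: derivative_eq_intros)
  from has_derivative_add[OF has_derivative_const[of z] bounded_linear.has_derivative[OF bl this]]
  have "((\<lambda>w. z + axis j (w - z $ j)) has_derivative axis j) (at (z $ j))"
    by simp
  moreover have "(f has_derivative (\<lambda>h. \<Sum>j\<in>UNIV. g j * h $ j)) (at (z + axis j (z $ j - z $ j)))"
    using assms by (simp add: axis_def zero_vec_def[symmetric])
  ultimately have "((\<lambda>w. f (z + axis j (w - z $ j))) has_derivative
      (\<lambda>h. \<Sum>i\<in>UNIV. g i * axis j h $ i)) (at (z $ j))"
    by (rule has_derivative_compose)
  moreover have "(\<Sum>i\<in>UNIV. g i * axis j h $ i) = g j * h" for h
    by (simp add: axis_def if_distrib sum.If_cases)
  ultimately have "((\<lambda>w. f (z + axis j (w - z $ j))) has_field_derivative g j) (at (z $ j))"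
    by (simp add: has_field_derivative_def)
  then show ?thesis
    by (simp add: cgrad_def line DERIV_imp_deriv)
qed

text \<open>Keeping the coefficients inside \<open>holo_poly\<close> makes differentiation
  repeatable; \<open>cgrad_eqI\<close> later identifies them with \<open>cgrad\<close>.\<close>

lemma holo_poly_has_derivative_ex:
  assumes "f \<in> holo_poly"
  shows "\<exists>g. (\<forall>j. g j \<in> holo_poly) \<and>
    (\<forall>z. (f has_derivative (\<lambda>h. \<Sum>j\<in>UNIV. g j z * h $ j)) (at z))"
  using assms
proof induction
  case (const c)
  show ?case
    by (rule exI[of _ "\<lambda>j z. 0"]) (auto intro: holo_poly.intros)
next
  case (coord j)
  have "(\<Sum>i\<in>UNIV. (if i = j then 1 else 0) * h $ i) = h $ j" for h :: "complex ^ 'a"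
    by (simp add: if_distrib if_distribR sum.If_cases)
  then show ?case
    by (intro exI[of _ "\<lambda>i z. if i = j then 1 else 0"])
      (auto intro: holo_poly.intros bounded_linear.has_derivative[OF bounded_linear_vec_nth has_derivative_ident])
next
  case (add f g)
  then obtain f' g' where *: "\<And>j. f' j \<in> holo_poly" "\<And>j. g' j \<in> holo_poly"
    "\<And>z. (f has_derivative (\<lambda>h. \<Sum>j\<in>UNIV. f' j z * h $ j)) (at z)"
    "\<And>z. (g has_derivative (\<lambda>h. \<Sum>j\<in>UNIV. g' j z * h $ j)) (at z)"
    by auto
  show ?case
    using has_derivative_add[OF *(3,4)] *(1,2)
    by (intro exI[of _ "\<lambda>j z. f' j z + g' j z"])
      (auto intro: holo_poly.intros simp: distrib_right sum.distrib)
next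
  case (mult f g)
  then obtain f' g' where *: "\<And>j. f' j \<in> holo_poly" "\<And>j. g' j \<in> holo_poly"
    "\<And>z. (f has_derivative (\<lambda>h. \<Sum>j\<in>UNIV. f' j z * h $ j)) (at z)"
    "\<And>z. (g has_derivative (\<lambda>h. \<Sum>j\<in>UNIV. g' j z * h $ j)) (at z)"
    by auto
  show ?case
    using has_derivative_mult[OF *(3,4)] *(1,2) mult.hyps
    by (intro exI[of _ "\<lambda>j z. f z * g' j z + f' j z * g z"] conjI allI holo_poly.add holo_poly.mult)
      (simp_all add: sum.distrib sum_distrib_left sum_distrib_right algebra_simps)
qed

lemma
  assumes "f \<in> holo_poly"
  shows holo_poly_has_derivative: "(f has_derivative (\<lambda>h. \<Sum>j\<in>UNIV. cgrad f z $ j * h $ j)) (at z)"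
    and holo_poly_cgrad: "(\<lambda>z. cgrad f z $ j) \<in> holo_poly"
proof -
  from holo_poly_has_derivative_ex[OF assms] obtain g where
    g: "\<And>j. g j \<in> holo_poly" "\<And>z. (f has_derivative (\<lambda>h. \<Sum>j\<in>UNIV. g j z * h $ j)) (at z)"
    by auto
  have "cgrad f z $ j = g j z" for z j
    by (rule cgrad_eqI[OF g(2)])
  with g show "(f has_derivative (\<lambda>h. \<Sum>j\<in>UNIV. cgrad f z $ j * h $ j)) (at z)"
    "(\<lambda>z. cgrad f z $ j) \<in> holo_poly"
    by auto
qed

lemma cgrad_mult:
  assumes "f \<in> holo_poly" "g \<in> holo_poly"
  shows "cgrad (\<lambda>z. f z * g z) z $ j = f z * cgrad g z $ j + cgrad f z $ j * g z"
  by (rule cgrad_eqI)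
    (use has_derivative_mult[OF assms[THEN holo_poly_has_derivative]] in
      \<open>simp add: sum.distrib sum_distrib_left sum_distrib_right algebra_simps\<close>)

lemma cgrad_const: "cgrad (\<lambda>z. c) z $ j = 0"
  by (rule cgrad_eqI) simp

lemma cgrad_coord: "cgrad (\<lambda>z. z $ i) z $ j = (if j = i then 1 else 0)"
proof (rule cgrad_eqI)
  have "(\<Sum>j\<in>UNIV. (if j = i then 1 else 0) * h $ j) = h $ i" for h :: "complex ^ 'a"
    by (simp add: if_distrib if_distribR sum.If_cases)
  then show "((\<lambda>z. z $ i) has_derivative (\<lambda>h. \<Sum>j\<in>UNIV. (if j = i then 1 else 0) * h $ j)) (at z)"
    by (auto intro: bounded_linear.has_derivative[OF bounded_linear_vec_nth has_derivative_ident])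
qed

section \<open>Derivatives along real directions and the Laplacian\<close>

definition dir_deriv :: "(complex ^ 'n \<Rightarrow> complex) \<Rightarrow> complex ^ 'n \<Rightarrow> complex ^ ('n::finite) \<Rightarrow> complex" where
  "dir_deriv f b z = (\<Sum>j\<in>UNIV. cgrad f z $ j * b $ j)"

lemma holo_poly_dir_deriv: "f \<in> holo_poly \<Longrightarrow> dir_deriv f b \<in> holo_poly"
  unfolding dir_deriv_def[abs_def] by (intro holo_poly_sum holo_poly.intros holo_poly_cgrad)

lemma holo_poly_line:
  assumes "f \<in> holo_poly"
  shows "((\<lambda>t. f (x + t *\<^sub>R b)) has_vector_derivative dir_deriv f b x) (at 0)"
proof -
  have "((\<lambda>t. x + t *\<^sub>R b) has_derivative (\<lambda>t. t *\<^sub>R b)) (at 0)"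
    by (auto intro!: derivative_eq_intros)
  moreover have "(f has_derivative (\<lambda>h. \<Sum>j\<in>UNIV. cgrad f x $ j * h $ j)) (at (x + 0 *\<^sub>R b))"
    using holo_poly_has_derivative[OF assms] by simp
  ultimately have "((\<lambda>t. f (x + t *\<^sub>R b)) has_derivative (\<lambda>t. \<Sum>j\<in>UNIV. cgrad f x $ j * (t *\<^sub>R b) $ j)) (at 0)"
    by (rule has_derivative_compose)
  then show ?thesis
    by (simp add: has_vector_derivative_def dir_deriv_def scaleR_sum_right)
qed

lemma sum_Basis_dir_deriv: "(\<Sum>b\<in>Basis. (x \<bullet> b) *\<^sub>R dir_deriv f b z) = dir_deriv f x z"
proof -
  have "(\<Sum>b\<in>Basis. (x \<bullet> b) *\<^sub>R dir_deriv f b z)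
      = (\<Sum>j\<in>UNIV. \<Sum>b\<in>Basis. cgrad f z $ j * ((x \<bullet> b) *\<^sub>R b) $ j)"
    unfolding dir_deriv_def scaleR_sum_right by (subst sum.swap) simp
  also have "\<dots> = (\<Sum>j\<in>UNIV. cgrad f z $ j * (\<Sum>b\<in>Basis. (x \<bullet> b) *\<^sub>R b) $ j)"
    by (simp add: sum_distrib_left sum_component)
  finally show ?thesis
    by (simp add: euclidean_representation dir_deriv_def)
qed

text \<open>Each complex coordinate contributes two real directions; real Laplacians thereby become
  sums over complex coordinates.\<close>

lemma sum_Basis_complex_vec:
  "(\<Sum>b\<in>(Basis :: (complex ^ 'n::finite) set). h b) = (\<Sum>j\<in>UNIV. h (axis j 1) + h (axis j \<i>))"
proof -
  have "bij_betw (\<lambda>p. axis (fst p) (snd p)) (UNIV \<times> Basis) (Basis :: (complex ^ 'n) set)"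
  proof (rule bij_betw_imageI)
    show "inj_on (\<lambda>p. axis (fst p) (snd p) :: complex ^ 'n) (UNIV \<times> Basis)"
      by (auto simp: inj_on_def axis_eq_axis)
    show "(\<lambda>p. axis (fst p) (snd p)) ` (UNIV \<times> Basis) = (Basis :: (complex ^ 'n) set)"
    proof (intro subset_antisym subsetI)
      fix x :: "complex ^ 'n"
      assume "x \<in> Basis"
      then obtain i u where "u \<in> Basis" "x = axis i u"
        by (auto simp: Basis_vec_def)
      then show "x \<in> (\<lambda>p. axis (fst p) (snd p)) ` (UNIV \<times> Basis)"
        by (intro image_eqI[of _ _ "(i, u)"]) auto
    qed auto
  qed
  from sum.reindex_bij_betw[OF this, of h]
  have "(\<Sum>b\<in>(Basis :: (complex ^ 'n) set). h b) = (\<Sum>(j, u)\<in>UNIV \<times> Basis. h (axis j u))"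
    by (simp only: case_prod_unfold)
  also have "\<dots> = (\<Sum>j\<in>UNIV. \<Sum>u\<in>Basis. h (axis j u))"
    by (simp add: sum.cartesian_product)
  finally show ?thesis
    by (simp add: Basis_complex_def)
qed

lemma dir_deriv_axis: "dir_deriv f (axis j u) z = u * cgrad f z $ j"
  by (simp add: dir_deriv_def axis_def if_distrib sum.If_cases)

text \<open>Holomorphic functions are harmonic: the second derivatives along \<open>axis j 1\<close>
  and \<open>axis j \<i>\<close> differ by the factor \<open>\<i> * \<i> = -1\<close> and
  cancel.\<close>

lemma sum_Basis_dir_deriv2:
  assumes "f \<in> holo_poly"
  shows "(\<Sum>b\<in>Basis. dir_deriv (dir_deriv f b) b z) = 0"
proof -
  have "dir_deriv (dir_deriv f (axis j u)) (axis j u) z = u * u * cgrad (\<lambda>z. cgrad f z $ j) z $ j" for j u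
    unfolding dir_deriv_axis[abs_def]
    by (simp add: cgrad_mult holo_poly.const holo_poly_cgrad assms cgrad_const)
  then show ?thesis
    by (simp add: sum_Basis_complex_vec)
qed

text \<open>Here the second direction carries \<open>\<i> * cnj \<i> = 1\<close>, so both real
  directions of a coordinate contribute the same term, whence the factor 2.\<close>

lemma sum_Basis_dir_deriv_cnj:
  "(\<Sum>b\<in>Basis. dir_deriv f b z * cnj (dir_deriv g b z)) = 2 * herm (cgrad f z) (cgrad g z)"
proof -
  have "cgrad f z $ j * cnj (cgrad g z $ j) + \<i> * cgrad f z $ j * cnj (\<i> * cgrad g z $ j)
      = 2 * (cgrad f z $ j * cnj (cgrad g z $ j))" for j
    by (simp add: complex_eq_iff algebra_simps)
  then show ?thesis
    unfolding sum_Basis_complex_vec dir_deriv_axis herm_def sum_distrib_left by simp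
qed

text \<open>Both factors of \<open>f x * cnj (g x)\<close> are harmonic, so only the mixed term of
  the Laplacian survives, and the first-order terms collapse to radial derivatives. The constant
  \<open>c\<close> affects the zeroth-order term alone.\<close>

lemma green_op_mult_cnj:
  fixes f g :: "complex ^ 'n::finite \<Rightarrow> complex"
  assumes f: "f \<in> holo_poly" and g: "g \<in> holo_poly"
  shows "green_op CARD('n)
      (\<lambda>b x. dir_deriv f b x * cnj (g x) + f x * cnj (dir_deriv g b x))
      (\<lambda>b x. dir_deriv (dir_deriv f b) b x * cnj (g x) + 2 * (dir_deriv f b x * cnj (dir_deriv g b x))
         + f x * cnj (dir_deriv (dir_deriv g b) b x))
      (\<lambda>x. f x * cnj (g x) - c) z
    = 4 * (of_nat CARD('n) * (f z * cnj (g z) - c) + dir_deriv f z z * cnj (g z) + f z * cnj (dir_deriv g z z)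
       - of_real (defect z) * herm (cgrad f z) (cgrad g z))"
proof -
  have 1: "(\<Sum>b\<in>Basis. (4 * (z \<bullet> b)) *\<^sub>R (dir_deriv f b z * cnj (g z) + f z * cnj (dir_deriv g b z)))
     = 4 * ((\<Sum>b\<in>Basis. (z \<bullet> b) *\<^sub>R dir_deriv f b z) * cnj (g z) + f z * cnj (\<Sum>b\<in>Basis. (z \<bullet> b) *\<^sub>R dir_deriv g b z))"
  proof -
    have "(4 * (z \<bullet> b)) *\<^sub>R (dir_deriv f b z * cnj (g z) + f z * cnj (dir_deriv g b z))
       = 4 * ((z \<bullet> b) *\<^sub>R dir_deriv f b z * cnj (g z) + f z * cnj ((z \<bullet> b) *\<^sub>R dir_deriv g b z))" for b
      by (simp only: scaleR_conv_of_real of_real_mult of_real_numeral complex_cnj_mult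
          complex_cnj_complex_of_real distrib_left mult.assoc mult.left_commute mult.commute)
    then show ?thesis
      by (simp only: sum.distrib sum_distrib_left[symmetric] sum_distrib_right[symmetric] cnj_sum[symmetric])
  qed
  have 2: "(\<Sum>b\<in>Basis. dir_deriv (dir_deriv f b) b z * cnj (g z) + 2 * (dir_deriv f b z * cnj (dir_deriv g b z))
         + f z * cnj (dir_deriv (dir_deriv g b) b z))
     = (\<Sum>b\<in>Basis. dir_deriv (dir_deriv f b) b z) * cnj (g z) + 2 * (\<Sum>b\<in>Basis. dir_deriv f b z * cnj (dir_deriv g b z))
         + f z * cnj (\<Sum>b\<in>Basis. dir_deriv (dir_deriv g b) b z)"
    by (simp only: sum.distrib sum_distrib_left[symmetric] sum_distrib_right[symmetric] cnj_sum[symmetric])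
  show ?thesis
    unfolding green_op_def 1 2 sum_Basis_dir_deriv sum_Basis_dir_deriv2[OF f] sum_Basis_dir_deriv2[OF g] sum_Basis_dir_deriv_cnj
    by (simp add: scaleR_conv_of_real algebra_simps)
qed

section \<open>The Poisson kernel of complex space and the formula for one boundary point\<close>

lemma poisson_kernel_eq:
  fixes z \<zeta> :: "complex ^ 'n::finite"
  shows "poisson_kernel z \<zeta> = defect z * inv_dist_pow \<zeta> CARD('n) z"
  by (simp add: poisson_kernel_def defect_def inv_dist_pow_def dot_square_norm power_mult divide_inverse power_inverse)

lemma DIM_complex_vec: "DIM(complex ^ 'n::finite) = 2 * CARD('n)"
  by simp

lemma continuous_bounded_on_unit_ball:
  fixes h :: "'a::euclidean_space \<Rightarrow> 'b::real_normed_vector"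
  assumes "continuous_on UNIV h"
  shows "\<exists>C\<ge>0. \<forall>x. norm x \<le> 1 \<longrightarrow> norm (h x) \<le> C"
proof -
  from compact_imp_bounded[OF compact_continuous_image[OF continuous_on_subset[OF assms] compact_cball]]
  obtain C where C: "\<And>x. norm x \<le> 1 \<Longrightarrow> norm (h x) \<le> C"
    unfolding bounded_iff by (metis imageI mem_cball_0 subset_UNIV)
  moreover have "0 \<le> C"
    using order_trans[OF norm_ge_zero C[of 0]] by simp
  ultimately show ?thesis
    by auto
qed

lemma poisson_kernel_nonneg: "norm z \<le> 1 \<Longrightarrow> 0 \<le> poisson_kernel z \<zeta>"
  unfolding poisson_kernel_eq by (rule poisson_nonneg)

lemma borel_measurable_poisson_kernel [measurable]:
  assumes [measurable]: "f \<in> borel_measurable M" "g \<in> borel_measurable M"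
  shows "(\<lambda>x. poisson_kernel (f x) (g x)) \<in> borel_measurable M"
  unfolding poisson_kernel_def by measurable

lemma set_integrable_poisson_kernel_mult:
  fixes h :: "complex ^ 'n::finite \<Rightarrow> complex"
  assumes h: "continuous_on UNIV h" and z: "norm \<zeta> = 1"
  shows "set_integrable lborel (ball 0 1) (\<lambda>z. h z * of_real (poisson_kernel z \<zeta>))"
proof -
  obtain C where C: "\<And>x. norm x \<le> 1 \<Longrightarrow> norm (h x) \<le> C" "0 \<le> C"
    using continuous_bounded_on_unit_ball[OF h] by auto
  have [measurable]: "h \<in> borel_measurable borel"
    using h by (rule borel_measurable_continuous_onI)
  have "set_integrable lborel (ball 0 1) (\<lambda>z. C * poisson_kernel z \<zeta>)"
    using set_integrable_poisson[OF DIM_complex_vec z] by (simp add: poisson_kernel_eq)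
  then show ?thesis
    unfolding set_integrable_def
  proof (rule Bochner_Integration.integrable_bound)
    have "(\<lambda>x. indicat_real (ball 0 1) x *\<^sub>R (h x * of_real (poisson_kernel x \<zeta>))) \<in> borel_measurable borel"
      by measurable simp_all
    then show "(\<lambda>x. indicat_real (ball 0 1) x *\<^sub>R (h x * of_real (poisson_kernel x \<zeta>))) \<in> borel_measurable lborel"
      by simp
    show "AE x in lborel. norm (indicat_real (ball 0 1) x *\<^sub>R (h x * of_real (poisson_kernel x \<zeta>)))
        \<le> norm (indicat_real (ball 0 1) x *\<^sub>R (C * poisson_kernel x \<zeta>))"
      using C by (intro AE_I2) (auto simp: indicator_def norm_mult abs_mult intro!: mult_right_mono)
  qed
qed

text \<open>The product \<open>f x * cnj (g x)\<close> is split into its deviation from the value at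
  \<open>\<zeta>\<close>, which contributes 0 by \<open>integral_poisson_green_op_eq_0\<close>, and
  that constant value, which is weighted with the total mass of the kernel.\<close>

lemma integral_poisson_kernel_green:
  fixes f g :: "complex ^ 'n::finite \<Rightarrow> complex"
  assumes f: "f \<in> holo_poly" and g: "g \<in> holo_poly" and z: "norm \<zeta> = 1"
  shows "(LINT z:ball 0 1|lborel. (of_nat CARD('n) * (f z * cnj (g z)) + dir_deriv f z z * cnj (g z)
        + f z * cnj (dir_deriv g z z) - of_real (defect z) * herm (cgrad f z) (cgrad g z)) * of_real (poisson_kernel z \<zeta>))
    = measure lborel (ball (0 :: complex ^ 'n) 1) *\<^sub>R (of_nat CARD('n) * (f \<zeta> * cnj (g \<zeta>)))"
proof -
  let ?d = "of_nat CARD('n) :: complex"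
  define E where "E z = ?d * (f z * cnj (g z)) + dir_deriv f z z * cnj (g z)
        + f z * cnj (dir_deriv g z z) - of_real (defect z) * herm (cgrad f z) (cgrad g z)" for z
  let ?c = "f \<zeta> * cnj (g \<zeta>)"
  let ?w = "\<lambda>x. f x * cnj (g x) - ?c"
  note cont = continuous_on_holo_poly[OF f] continuous_on_holo_poly[OF g]
    continuous_on_holo_poly[OF holo_poly_cgrad[OF f]] continuous_on_holo_poly[OF holo_poly_cgrad[OF g]]
    continuous_on_holo_poly[OF holo_poly_dir_deriv[OF f]] continuous_on_holo_poly[OF holo_poly_dir_deriv[OF g]]
    continuous_on_holo_poly[OF holo_poly_dir_deriv[OF holo_poly_dir_deriv[OF f]]]
    continuous_on_holo_poly[OF holo_poly_dir_deriv[OF holo_poly_dir_deriv[OF g]]]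
  obtain Lf Lg where "Lf \<ge> 0" "Lg \<ge> 0"
    and Lf: "\<And>x. norm x \<le> 1 \<Longrightarrow> norm (f x - f \<zeta>) \<le> Lf * norm (x - \<zeta>)"
    and Lg: "\<And>x. norm x \<le> 1 \<Longrightarrow> norm (g x - g \<zeta>) \<le> Lg * norm (x - \<zeta>)"
    using holo_poly_Lipschitz[OF f, of \<zeta>] holo_poly_Lipschitz[OF g, of \<zeta>] z by auto
  obtain C where C: "\<And>x. norm x \<le> 1 \<Longrightarrow> norm (f x) \<le> C" "0 \<le> C"
    using continuous_bounded_on_unit_ball[OF cont(1)] by auto
  have lip: "norm (?w x) \<le> (C * Lg + Lf * norm (g \<zeta>)) * norm (x - \<zeta>)" if x: "norm x < 1" for x
  proof -
    have "?w x = f x * cnj (g x - g \<zeta>) + (f x - f \<zeta>) * cnj (g \<zeta>)"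
      by (simp add: algebra_simps)
    then have "norm (?w x) \<le> norm (f x) * norm (g x - g \<zeta>) + norm (f x - f \<zeta>) * norm (g \<zeta>)"
      by (metis complex_mod_cnj norm_mult norm_triangle_ineq)
    also have "\<dots> \<le> C * (Lg * norm (x - \<zeta>)) + (Lf * norm (x - \<zeta>)) * norm (g \<zeta>)"
      using x C \<open>Lf \<ge> 0\<close> by (intro add_mono mult_mono C Lf Lg) auto
    finally show ?thesis
      by (simp add: algebra_simps)
  qed
  have "(LINT z:ball 0 1|lborel. (defect z * inv_dist_pow \<zeta> CARD('n) z) *\<^sub>R
      green_op CARD('n)
      (\<lambda>b x. dir_deriv f b x * cnj (g x) + f x * cnj (dir_deriv g b x))
      (\<lambda>b x. dir_deriv (dir_deriv f b) b x * cnj (g x) + 2 * (dir_deriv f b x * cnj (dir_deriv g b x))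
         + f x * cnj (dir_deriv (dir_deriv g b) b x)) ?w z) = 0"
  proof (rule integral_poisson_green_op_eq_0[OF DIM_complex_vec z])
    fix b x :: "complex ^ 'n"
    note line = holo_poly_line[where x = x and b = b]
    note line = line[OF f] has_vector_derivative_cnj[OF line[OF g]]
      line[OF holo_poly_dir_deriv[OF f, of b]] has_vector_derivative_cnj[OF line[OF holo_poly_dir_deriv[OF g, of b]]]
    show "((\<lambda>t. ?w (x + t *\<^sub>R b)) has_vector_derivative
        dir_deriv f b x * cnj (g x) + f x * cnj (dir_deriv g b x)) (at 0)"
      using has_vector_derivative_diff[OF has_vector_derivative_mult[OF line(1,2)] has_vector_derivative_const[of ?c]]
      by (simp add: add.commute)
    show "((\<lambda>t. dir_deriv f b (x + t *\<^sub>R b) * cnj (g (x + t *\<^sub>R b))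
         + f (x + t *\<^sub>R b) * cnj (dir_deriv g b (x + t *\<^sub>R b))) has_vector_derivative
        dir_deriv (dir_deriv f b) b x * cnj (g x) + 2 * (dir_deriv f b x * cnj (dir_deriv g b x))
         + f x * cnj (dir_deriv (dir_deriv g b) b x)) (at 0)"
      using has_vector_derivative_add[OF has_vector_derivative_mult[OF line(3,2)] has_vector_derivative_mult[OF line(1,4)]]
      by (simp add: algebra_simps)
  qed (use lip set_integrable_poisson[OF DIM_complex_vec z] in
      \<open>auto intro!: continuous_intros cont\<close>)
  \<comment> \<open>Subtracting the constant \<open>?c\<close> lowers \<open>E\<close> by
    \<open>?d * ?c\<close> only, because the derivatives of a constant vanish.\<close>
  then have "(LINT z:ball 0 1|lborel. 4 * (E z * of_real (poisson_kernel z \<zeta>)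
      - ?d * ?c * of_real (poisson_kernel z \<zeta>))) = 0"
    unfolding green_op_mult_cnj[OF f g] E_def poisson_kernel_eq
    by (simp add: scaleR_conv_of_real algebra_simps)
  then have "(LINT z:ball 0 1|lborel. E z * of_real (poisson_kernel z \<zeta>)
      - ?d * ?c * of_real (poisson_kernel z \<zeta>)) = 0"
    unfolding set_integral_mult_right by simp
  moreover have "set_integrable lborel (ball 0 1) (\<lambda>z. E z * of_real (poisson_kernel z \<zeta>))"
    unfolding E_def dir_deriv_def herm_def
    by (intro set_integrable_poisson_kernel_mult z continuous_intros cont)
  moreover have "set_integrable lborel (ball 0 1) (\<lambda>z. ?d * ?c * of_real (poisson_kernel z \<zeta>))"
    by (intro set_integrable_poisson_kernel_mult z continuous_intros)
  ultimately have "(LINT z:ball 0 1|lborel. E z * of_real (poisson_kernel z \<zeta>))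
      = (LINT z:ball 0 1|lborel. ?d * ?c * of_real (poisson_kernel z \<zeta>))"
    by (simp add: set_integral_diff)
  also have "\<dots> = ?d * ?c * (LINT z:ball 0 1|lborel. of_real (poisson_kernel z \<zeta>))"
    by simp
  also have "(LINT z:ball 0 1|lborel. complex_of_real (poisson_kernel z \<zeta>))
      = of_real (measure lborel (ball (0 :: complex ^ 'n) 1))"
    unfolding set_integral_complex_of_real poisson_kernel_eq integral_poisson[OF DIM_complex_vec z] ..
  finally show ?thesis
    by (simp add: E_def scaleR_conv_of_real mult_ac)
qed

section \<open>Poisson integrals of measures\<close>

text \<open>A real-valued density is the form to which \<open>integral_density\<close> and
  \<open>integrable_density\<close> apply.\<close>

lemma vol_eq_density:
  "(vol :: (complex ^ 'n::finite) measure) =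
     density lborel (\<lambda>z. ennreal (indicator (ball 0 1) z / measure lborel (ball (0 :: complex ^ 'n) 1)))"
proof -
  let ?B = "ball (0 :: complex ^ 'n) 1"
  have m: "emeasure lborel ?B = ennreal (measure lborel ?B)"
    using emeasure_bounded_finite[of ?B] by (intro emeasure_eq_ennreal_measure) auto
  have "indicator ?B z / emeasure lborel ?B = ennreal (indicator ?B z / measure lborel ?B)" for z
    unfolding m using content_ball_pos[of 1 "0 :: complex ^ 'n"]
    by (auto simp: indicator_def divide_ennreal simp flip: ennreal_1)
  then show ?thesis
    by (simp add: vol_def uniform_measure_def)
qed

lemma
  fixes h :: "complex ^ 'n::finite \<Rightarrow> 'b::euclidean_space"
  assumes [measurable]: "h \<in> borel_measurable borel"
  shows set_integral_vol: "(LINT z:ball 0 1|vol. h z) =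
      (LINT z:ball 0 1|lborel. h z) /\<^sub>R measure lborel (ball (0 :: complex ^ 'n) 1)"
    and set_integrable_vol: "set_integrable lborel (ball 0 1) h \<Longrightarrow> set_integrable vol (ball 0 1) h"
proof -
  let ?B = "ball (0 :: complex ^ 'n) 1"
  have B [measurable]: "?B \<in> sets borel"
    by simp
  have m: "(indicator ?B z / measure lborel ?B) *\<^sub>R (indicator ?B z *\<^sub>R h z)
      = inverse (measure lborel ?B) *\<^sub>R (indicator ?B z *\<^sub>R h z)" for z
    by (simp add: indicator_def divide_inverse)
  have "(\<lambda>z. indicator ?B z *\<^sub>R h z) \<in> borel_measurable borel"
    by measurable
  then have h: "(\<lambda>z. indicator ?B z *\<^sub>R h z) \<in> borel_measurable lborel"
    by simp
  have d: "(\<lambda>z. indicator ?B z / measure lborel ?B) \<in> borel_measurable lborel"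
    by simp
  have n: "AE z in lborel. 0 \<le> indicator ?B z / measure lborel ?B"
    by simp
  show "(LINT z:?B|vol. h z) = (LINT z:?B|lborel. h z) /\<^sub>R measure lborel ?B"
    unfolding set_lebesgue_integral_def vol_eq_density integral_density[OF h d n] m by (rule integral_scaleR_right)
  show "set_integrable vol ?B h" if "set_integrable lborel ?B h"
    using that unfolding set_integrable_def vol_eq_density integrable_density[OF h d n] m by (rule integrable_scaleR_right)
qed

lemma sets_vol [measurable_cong]: "sets vol = sets borel"
  by (simp add: vol_def)

lemma space_vol [simp]: "space vol = UNIV"
  by (simp add: vol_def)

lemma sigma_finite_vol: "sigma_finite_measure (vol :: (complex ^ 'n::finite) measure)"
proof -
  have "emeasure lborel (ball (0 :: complex ^ 'n) 1) \<noteq> 0"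
    using content_ball_pos[of 1 "0 :: complex ^ 'n"] by (auto simp: measure_def)
  then have "emeasure (vol :: (complex ^ 'n) measure) (space vol) \<noteq> \<infinity>"
    using emeasure_bounded_finite[of "ball (0 :: complex ^ 'n) 1"]
    by (simp add: vol_def emeasure_uniform_measure ennreal_divide_eq_top_iff)
  then show ?thesis
    by (rule finite_measure.axioms(1)[OF finite_measureI])
qed

lemma set_integral_poisson_kernel_vol:
  fixes \<zeta> :: "complex ^ 'n::finite"
  assumes "norm \<zeta> = 1"
  shows "(LINT z:ball 0 1|vol. poisson_kernel z \<zeta>) = 1"
  using integral_poisson[OF DIM_complex_vec assms] content_ball_pos[of 1 "0 :: complex ^ 'n"]
  by (subst set_integral_vol) (auto simp: poisson_kernel_eq[symmetric])

section \<open>Fubini for Poisson integrals of a measure on the sphere\<close>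

context
  fixes \<mu> :: "(complex ^ 'n::finite) measure"
  assumes fin: "finite_measure \<mu>"
    and sets_mu: "sets \<mu> = sets (restrict_space borel (sphere (0 :: complex ^ 'n) 1))"
begin

lemma space_sphere: "space \<mu> = sphere 0 1"
  using sets_eq_imp_space_eq[OF sets_mu] by (simp add: space_restrict_space)

lemma borel_measurable_sphere:
  "h \<in> borel_measurable borel \<Longrightarrow> h \<in> borel_measurable \<mu>"
  using measurable_restrict_space1[of h borel borel] measurable_cong_sets[OF sets_mu refl] by blast

text \<open>Fubini applies because \<open>h\<close> is bounded on the ball and every kernel has
  normalized mass 1: the inner integrals of norms stay below one constant, which is integrable over
  a finite measure.\<close>

lemma
  fixes h :: "complex ^ 'n \<Rightarrow> complex"
  assumes h: "continuous_on UNIV h"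
  shows set_integrable_poisson_measure: "set_integrable vol (ball 0 1) (\<lambda>z. h z * of_real (poisson \<mu> z))"
    and set_integral_poisson_measure: "(LINT z:ball 0 1|vol. h z * of_real (poisson \<mu> z))
      = (LINT \<zeta>|\<mu>. (LINT z:ball 0 1|vol. h z * of_real (poisson_kernel z \<zeta>)))"
proof -
  interpret finite_measure \<mu>
    by (rule fin)
  interpret V: sigma_finite_measure "vol :: (complex ^ 'n) measure"
    by (rule sigma_finite_vol)
  interpret P: pair_sigma_finite \<mu> "vol :: (complex ^ 'n) measure" ..
  obtain C where C: "\<And>x. norm x \<le> 1 \<Longrightarrow> norm (h x) \<le> C" "0 \<le> C"
    using continuous_bounded_on_unit_ball[OF h] by auto
  have hm [measurable]: "h \<in> borel_measurable borel"
    using h by (rule borel_measurable_continuous_onI)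
  have B [measurable]: "ball (0 :: complex ^ 'n) 1 \<in> sets borel"
    by simp
  \<comment> \<open>The identity is measurable from the restricted sigma-algebra of the sphere into
    \<open>borel\<close>; the joint measurability of the kernel rests on this.\<close>
  have id [measurable]: "(\<lambda>\<zeta>. \<zeta>) \<in> borel_measurable \<mu>"
    by (rule borel_measurable_sphere) simp
  define H where "H \<zeta> z = indicator (ball 0 1) z *\<^sub>R (h z * of_real (poisson_kernel z \<zeta>))" for \<zeta> z
  have meas: "case_prod H \<in> borel_measurable (\<mu> \<Otimes>\<^sub>M vol)"
    unfolding H_def[abs_def] case_prod_unfold by measurable
  have int: "integrable vol (H \<zeta>)" if "\<zeta> \<in> space \<mu>" for \<zeta>
    unfolding H_def set_integrable_def[symmetric] using that
    by (intro set_integrable_vol set_integrable_poisson_kernel_mult h) (auto simp: space_sphere)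
  have bound: "norm (LINT z|vol. norm (H \<zeta> z)) \<le> C" if "\<zeta> \<in> space \<mu>" for \<zeta>
  proof -
    have z: "norm \<zeta> = 1"
      using that by (simp add: space_sphere)
    have i: "set_integrable vol (ball 0 1) (\<lambda>z. poisson_kernel z \<zeta>)"
      using set_integrable_poisson[OF DIM_complex_vec z]
      by (intro set_integrable_vol) (auto simp: poisson_kernel_eq[symmetric])
    have "(LINT z|vol. norm (H \<zeta> z)) \<le> (LINT z|vol. C * (indicator (ball 0 1) z *\<^sub>R poisson_kernel z \<zeta>))"
    proof (rule integral_mono)
      show "integrable vol (\<lambda>z. norm (H \<zeta> z))"
        using int[OF that] by simp
      show "integrable vol (\<lambda>z. C * (indicator (ball 0 1) z *\<^sub>R poisson_kernel z \<zeta>))"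
        using i unfolding set_integrable_def by (rule integrable_mult_right)
      show "norm (H \<zeta> z) \<le> C * (indicator (ball 0 1) z *\<^sub>R poisson_kernel z \<zeta>)" for z
        using C poisson_kernel_nonneg[of z \<zeta>]
        by (auto simp: H_def indicator_def norm_mult intro!: mult_right_mono)
    qed
    also have "\<dots> = C"
      using set_integral_poisson_kernel_vol[OF z] by (simp add: set_lebesgue_integral_def)
    finally show ?thesis
      by simp
  qed
  have intH: "integrable (\<mu> \<Otimes>\<^sub>M vol) (case_prod H)"
  proof (rule P.Fubini_integrable[OF meas])
    show "integrable \<mu> (\<lambda>\<zeta>. LINT z|vol. norm (case_prod H (\<zeta>, z)))"
    proof (rule integrable_const_bound[where B = C])
      show "AE \<zeta> in \<mu>. norm (LINT z|vol. norm (case_prod H (\<zeta>, z))) \<le> C"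
        using bound by (intro AE_I2) simp
      show "(\<lambda>\<zeta>. LINT z|vol. norm (case_prod H (\<zeta>, z))) \<in> borel_measurable \<mu>"
        using meas by measurable
    qed
    show "AE \<zeta> in \<mu>. integrable vol (\<lambda>z. case_prod H (\<zeta>, z))"
      using int by (intro AE_I2) simp
  qed
  have inner: "(LINT \<zeta>|\<mu>. H \<zeta> z) = indicator (ball 0 1) z *\<^sub>R (h z * of_real (poisson \<mu> z))" for z
    unfolding H_def poisson_def by simp
  show "set_integrable vol (ball 0 1) (\<lambda>z. h z * of_real (poisson \<mu> z))"
    using P.integrable_snd[OF intH] unfolding inner set_integrable_def .
  show "(LINT z:ball 0 1|vol. h z * of_real (poisson \<mu> z))
      = (LINT \<zeta>|\<mu>. (LINT z:ball 0 1|vol. h z * of_real (poisson_kernel z \<zeta>)))"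
  proof -
    have "(LINT z|vol. LINT \<zeta>|\<mu>. H \<zeta> z) = (LINT \<zeta>|\<mu>. LINT z|vol. H \<zeta> z)"
      by (rule P.Fubini_integral[OF intH])
    then show ?thesis
      unfolding inner unfolding H_def set_lebesgue_integral_def .
  qed
qed

end

section \<open>Multiplication by one coordinate\<close>

lemma continuous_on_herm_cgrad:
  assumes "f \<in> holo_poly" "g \<in> holo_poly"
  shows "continuous_on S (\<lambda>z. herm (cgrad f z) (cgrad g z))"
  unfolding herm_def
  by (intro continuous_intros continuous_on_holo_poly holo_poly_cgrad assms)

lemma holo_poly_coord_mult: "f \<in> holo_poly \<Longrightarrow> (\<lambda>z. z $ j * f z) \<in> holo_poly"
  by (intro holo_poly.intros)

lemma sum_mult_cnj_eq:
  fixes z :: "complex ^ 'n::finite"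
  shows "(\<Sum>j\<in>UNIV. z $ j * cnj (z $ j)) = of_real (z \<bullet> z)"
  by (simp add: inner_vec_def complex_norm_square[symmetric] dot_square_norm)

text \<open>The gradient of \<open>z $ j * f z\<close> is \<open>z $ j\<close> times that of
  \<open>f\<close>, plus \<open>f z\<close> in component \<open>j\<close>. In the products the
  squares add up to \<open>|z|\<^sup>2 = 1 - defect z\<close>, the cross terms to radial
  derivatives, and the remaining term occurs once per coordinate.\<close>

lemma sum_herm_cgrad_coord:
  fixes f g :: "complex ^ 'n::finite \<Rightarrow> complex"
  assumes f: "f \<in> holo_poly" and g: "g \<in> holo_poly"
  shows "(\<Sum>j\<in>UNIV. herm (cgrad (\<lambda>z. z $ j * f z) z) (cgrad (\<lambda>z. z $ j * g z) z))
    = herm (cgrad f z) (cgrad g z) + (of_nat CARD('n) * (f z * cnj (g z)) + dir_deriv f z z * cnj (g z)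
        + f z * cnj (dir_deriv g z z) - of_real (defect z) * herm (cgrad f z) (cgrad g z))"
proof -
  have c: "cgrad (\<lambda>z. z $ j * f z) z $ i = z $ j * cgrad f z $ i + (if i = j then f z else 0)"
    if "f \<in> holo_poly" for f :: "complex ^ 'n \<Rightarrow> complex" and i j
    by (simp add: cgrad_mult[OF holo_poly.coord that] cgrad_coord)
  have "herm (cgrad (\<lambda>z. z $ j * f z) z) (cgrad (\<lambda>z. z $ j * g z) z)
      = z $ j * cnj (z $ j) * herm (cgrad f z) (cgrad g z) + f z * cnj (z $ j * cgrad g z $ j)
        + z $ j * cgrad f z $ j * cnj (g z) + f z * cnj (g z)" for j
  proof -
    have "(z $ j * cgrad f z $ i + (if i = j then f z else 0)) * cnj (z $ j * cgrad g z $ i + (if i = j then g z else 0))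
      = z $ j * cnj (z $ j) * (cgrad f z $ i * cnj (cgrad g z $ i))
        + (if i = j then f z * cnj (z $ j * cgrad g z $ j) + z $ j * cgrad f z $ j * cnj (g z) + f z * cnj (g z) else 0)" for i
      by (simp add: algebra_simps)
    then show ?thesis
      unfolding herm_def c[OF f] c[OF g] sum_distrib_left by (simp add: sum.distrib)
  qed
  then have "(\<Sum>j\<in>UNIV. herm (cgrad (\<lambda>z. z $ j * f z) z) (cgrad (\<lambda>z. z $ j * g z) z))
     = of_real (z \<bullet> z) * herm (cgrad f z) (cgrad g z) + f z * cnj (\<Sum>j\<in>UNIV. cgrad g z $ j * z $ j)
       + (\<Sum>j\<in>UNIV. cgrad f z $ j * z $ j) * cnj (g z) + of_nat CARD('n) * (f z * cnj (g z))"
    by (simp add: sum_mult_cnj_eq[symmetric] sum.distrib sum_distrib_left sum_distrib_right mult_ac)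
  then show ?thesis
    by (simp add: dir_deriv_def defect_def algebra_simps)
qed

text \<open>The case \<open>k = 1\<close>. The surplus \<open>E\<close> found in
  \<open>sum_herm_cgrad_coord\<close> is integrated over the ball for each boundary point first,
  which Fubini permits.\<close>

lemma sum_dirichlet_coord:
  fixes \<mu> :: "(complex ^ 'n::finite) measure"
  assumes fin: "finite_measure \<mu>"
    and sets_mu: "sets \<mu> = sets (restrict_space borel (sphere (0 :: complex ^ 'n) 1))"
    and f: "f \<in> holo_poly" and g: "g \<in> holo_poly"
  shows "(\<Sum>j\<in>UNIV. LINT z:ball 0 1|vol.
        herm (cgrad (\<lambda>z. z $ j * f z) z) (cgrad (\<lambda>z. z $ j * g z) z) * of_real (poisson \<mu> z))
    = (LINT z:ball 0 1|vol. herm (cgrad f z) (cgrad g z) * of_real (poisson \<mu> z))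
      + of_nat CARD('n) * (LINT \<zeta>|\<mu>. f \<zeta> * cnj (g \<zeta>))"
proof -
  define E where "E z = of_nat CARD('n) * (f z * cnj (g z)) + dir_deriv f z z * cnj (g z)
        + f z * cnj (dir_deriv g z z) - of_real (defect z) * herm (cgrad f z) (cgrad g z)" for z
  have cE: "continuous_on UNIV E"
    unfolding E_def[abs_def] dir_deriv_def
    by (intro continuous_intros continuous_on_holo_poly continuous_on_herm_cgrad holo_poly_cgrad f g)
  have [measurable]: "E \<in> borel_measurable borel"
    using cE by (rule borel_measurable_continuous_onI)
  let ?H = "\<lambda>j z. herm (cgrad (\<lambda>z. z $ j * f z) z) (cgrad (\<lambda>z. z $ j * g z) z)"
  note int = set_integrable_poisson_measure[OF fin sets_mu]
  have "(\<Sum>j\<in>UNIV. LINT z:ball 0 1|vol. ?H j z * of_real (poisson \<mu> z))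
      = (LINT z:ball 0 1|vol. (\<Sum>j\<in>UNIV. ?H j z * of_real (poisson \<mu> z)))"
    by (intro set_integral_sum[symmetric] int continuous_on_herm_cgrad holo_poly_coord_mult f g)
  also have "\<dots> = (LINT z:ball 0 1|vol. herm (cgrad f z) (cgrad g z) * of_real (poisson \<mu> z)
       + E z * of_real (poisson \<mu> z))"
    unfolding sum_distrib_right[symmetric] sum_herm_cgrad_coord[OF f g] E_def[symmetric]
    by (simp add: distrib_right)
  also have "\<dots> = (LINT z:ball 0 1|vol. herm (cgrad f z) (cgrad g z) * of_real (poisson \<mu> z))
       + (LINT z:ball 0 1|vol. E z * of_real (poisson \<mu> z))"
    by (intro set_integral_add int cE continuous_on_herm_cgrad f g)
  also have "(LINT z:ball 0 1|vol. E z * of_real (poisson \<mu> z))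
      = (LINT \<zeta>|\<mu>. (LINT z:ball 0 1|vol. E z * of_real (poisson_kernel z \<zeta>)))"
    by (rule set_integral_poisson_measure[OF fin sets_mu cE])
  also have "\<dots> = (LINT \<zeta>|\<mu>. of_nat CARD('n) * (f \<zeta> * cnj (g \<zeta>)))"
  proof (rule Bochner_Integration.integral_cong[OF refl])
    fix \<zeta> assume "\<zeta> \<in> space \<mu>"
    then have z: "norm \<zeta> = 1"
      by (simp add: space_sphere[OF fin sets_mu])
    have "(\<lambda>z. E z * of_real (poisson_kernel z \<zeta>)) \<in> borel_measurable borel"
      by measurable
    then have "(LINT z:ball 0 1|vol. E z * of_real (poisson_kernel z \<zeta>))
       = (LINT z:ball 0 1|lborel. E z * of_real (poisson_kernel z \<zeta>)) /\<^sub>R measure lborel (ball (0 :: complex ^ 'n) 1)"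
      by (rule set_integral_vol)
    \<comment> \<open>The volume factor in \<open>integral_poisson_kernel_green\<close> cancels
      against the normalization of \<open>vol\<close>.\<close>
    then show "(LINT z:ball 0 1|vol. E z * of_real (poisson_kernel z \<zeta>)) = of_nat CARD('n) * (f \<zeta> * cnj (g \<zeta>))"
      using integral_poisson_kernel_green[OF f g z] content_ball_pos[of 1 "0 :: complex ^ 'n"]
      by (simp add: E_def)
  qed
  finally show ?thesis
    by simp
qed

section \<open>Multi-indices\<close>

lemma finite_mi_abs: "finite {\<gamma> :: ('n::finite) multi_index. mi_abs \<gamma> = k}"
proof (rule finite_imageD)
  have "Poly_Mapping.lookup \<gamma> j \<le> k" if "mi_abs \<gamma> = k" for \<gamma> :: "'n multi_index" and j
    using member_le_sum[of j UNIV "Poly_Mapping.lookup \<gamma>"] that by (simp add: mi_abs_def)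
  then have "Poly_Mapping.lookup ` {\<gamma> :: 'n multi_index. mi_abs \<gamma> = k} \<subseteq> PiE UNIV (\<lambda>_. {..k})"
    by auto
  then show "finite (Poly_Mapping.lookup ` {\<gamma> :: 'n multi_index. mi_abs \<gamma> = k})"
    by (rule finite_subset) (auto intro: finite_PiE)
  show "inj_on Poly_Mapping.lookup {\<gamma> :: 'n multi_index. mi_abs \<gamma> = k}"
    by (auto simp: inj_on_def intro: poly_mapping_eqI)
qed

abbreviation unit_index :: "'n \<Rightarrow> 'n multi_index" where
  "unit_index j \<equiv> Poly_Mapping.single j 1"

lemma mi_abs_add_unit: "mi_abs (\<gamma> + unit_index j) = Suc (mi_abs \<gamma>)"
  by (simp add: mi_abs_def lookup_add sum.distrib lookup_single when_def)

lemma mi_pow_add_unit: "mi_pow z (\<gamma> + unit_index j) = mi_pow z \<gamma> * z $ j"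
proof -
  have "z $ i ^ Poly_Mapping.lookup (\<gamma> + unit_index j) i = z $ i ^ Poly_Mapping.lookup \<gamma> i * (if i = j then z $ j else 1)" for i
    by (simp add: lookup_add lookup_single when_def)
  then show ?thesis
    by (simp add: mi_pow_def prod.distrib)
qed

lemma mi_fact_add_unit: "mi_fact (\<gamma> + unit_index j) = Suc (Poly_Mapping.lookup \<gamma> j) * mi_fact \<gamma>"
proof -
  have "fact (Poly_Mapping.lookup (\<gamma> + unit_index j) i) = fact (Poly_Mapping.lookup \<gamma> i) * (if i = j then Suc (Poly_Mapping.lookup \<gamma> j) else 1)" for i
    by (simp add: lookup_add lookup_single when_def)
  then show ?thesis
    by (simp add: mi_fact_def prod.distrib)
qed

lemma mi_fact_pos: "0 < mi_fact \<gamma>"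
  by (simp add: mi_fact_def prod_pos)

lemma mi_pow_add: "mi_pow z (\<gamma> + \<delta>) = mi_pow z \<gamma> * mi_pow z \<delta>"
  by (simp add: mi_pow_def lookup_add power_add prod.distrib)

text \<open>Multinomial form of Pascal's rule: \<open>(k + 1)! / \<gamma>! = \<Sum>\<^sub>j \<gamma>\<^sub>j k! / \<gamma>!\<close> if \<open>|\<gamma>| = k + 1\<close>.\<close>

lemma sum_multinomial_Suc:
  fixes B :: "('n::finite) multi_index \<Rightarrow> complex"
  shows "(\<Sum>\<gamma> | mi_abs \<gamma> = Suc k. of_nat (fact (Suc k)) / of_nat (mi_fact \<gamma>) * B \<gamma>)
    = (\<Sum>j\<in>UNIV. \<Sum>\<gamma> | mi_abs \<gamma> = k. of_nat (fact k) / of_nat (mi_fact \<gamma>) * B (\<gamma> + unit_index j))"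
proof -
  let ?A = "\<lambda>k. {\<gamma> :: 'n multi_index. mi_abs \<gamma> = k}"
  have "(\<Sum>\<gamma>\<in>?A (Suc k). of_nat (fact (Suc k)) / of_nat (mi_fact \<gamma>) * B \<gamma>)
      = (\<Sum>\<gamma>\<in>?A (Suc k). \<Sum>j\<in>UNIV. of_nat (Poly_Mapping.lookup \<gamma> j) * (of_nat (fact k) / of_nat (mi_fact \<gamma>) * B \<gamma>))"
  proof (rule sum.cong[OF refl])
    fix \<gamma> :: "'n multi_index"
    assume "\<gamma> \<in> ?A (Suc k)"
    then have "(\<Sum>j\<in>UNIV. of_nat (Poly_Mapping.lookup \<gamma> j)) = (of_nat (Suc k) :: complex)"
      by (simp add: mi_abs_def flip: of_nat_sum)
    then show "of_nat (fact (Suc k)) / of_nat (mi_fact \<gamma>) * B \<gamma>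
        = (\<Sum>j\<in>UNIV. of_nat (Poly_Mapping.lookup \<gamma> j) * (of_nat (fact k) / of_nat (mi_fact \<gamma>) * B \<gamma>))"
      unfolding sum_distrib_right[symmetric] by (simp add: algebra_simps)
  qed
  also have "\<dots> = (\<Sum>j\<in>UNIV. \<Sum>\<gamma>\<in>?A (Suc k). of_nat (Poly_Mapping.lookup \<gamma> j) * (of_nat (fact k) / of_nat (mi_fact \<gamma>) * B \<gamma>))"
    by (rule sum.swap)
  also have "\<dots> = (\<Sum>j\<in>UNIV. \<Sum>\<gamma>\<in>?A k. of_nat (fact k) / of_nat (mi_fact \<gamma>) * B (\<gamma> + unit_index j))"
  proof (rule sum.cong[OF refl])
    fix j :: 'n
    let ?g = "\<lambda>\<gamma>. of_nat (Poly_Mapping.lookup \<gamma> j) * (of_nat (fact k) / of_nat (mi_fact \<gamma>) * B \<gamma>)"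
    \<comment> \<open>An index that is not a shift by \<open>unit_index j\<close> has
      \<open>j\<close>-th entry 0, so its weight removes it from the sum.\<close>
    have "sum ?g (?A (Suc k)) = sum ?g ((\<lambda>\<gamma>. \<gamma> + unit_index j) ` ?A k)"
    proof (rule sum.mono_neutral_right[OF finite_mi_abs])
      show "(\<lambda>\<gamma>. \<gamma> + unit_index j) ` ?A k \<subseteq> ?A (Suc k)"
        by (auto simp: mi_abs_add_unit simp del: One_nat_def)
      show "\<forall>\<gamma>\<in>?A (Suc k) - (\<lambda>\<gamma>. \<gamma> + unit_index j) ` ?A k. ?g \<gamma> = 0"
      proof
        fix \<gamma> assume \<gamma>: "\<gamma> \<in> ?A (Suc k) - (\<lambda>\<gamma>. \<gamma> + unit_index j) ` ?A k"
        have "Poly_Mapping.lookup \<gamma> j = 0"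
        proof (rule ccontr)
          assume "Poly_Mapping.lookup \<gamma> j \<noteq> 0"
          \<comment> \<open>Subtraction of multi-indices truncates, but it is exact here because the
            \<open>j\<close>-th entry is positive.\<close>
          then have eq: "\<gamma> = (\<gamma> - unit_index j) + unit_index j"
            by (intro poly_mapping_eqI) (auto simp: lookup_add lookup_minus lookup_single when_def)
          then have "mi_abs (\<gamma> - unit_index j) = k"
            using \<gamma> mi_abs_add_unit[of "\<gamma> - unit_index j" j] by simp
          with eq \<gamma> show False
            by blast
        qed
        then show "?g \<gamma> = 0"
          by simp
      qed
    qed
    also have "\<dots> = (\<Sum>\<gamma>\<in>?A k. ?g (\<gamma> + unit_index j))"
      by (subst sum.reindex) (auto simp: inj_on_def)
    also have "\<dots> = (\<Sum>\<gamma>\<in>?A k. of_nat (fact k) / of_nat (mi_fact \<gamma>) * B (\<gamma> + unit_index j))"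
    proof (rule sum.cong[OF refl])
      fix \<gamma> :: "'n multi_index"
      have "Poly_Mapping.lookup (\<gamma> + unit_index j) j = Suc (Poly_Mapping.lookup \<gamma> j)"
        by (simp add: lookup_add)
      \<comment> \<open>The weight of the shifted index cancels the factor by which
        \<open>mi_fact\<close> has grown.\<close>
      then show "?g (\<gamma> + unit_index j) = of_nat (fact k) / of_nat (mi_fact \<gamma>) * B (\<gamma> + unit_index j)"
        using mi_fact_pos[of \<gamma>] unfolding mi_fact_add_unit by (simp del: of_nat_Suc mult_Suc)
    qed
    finally show "sum ?g (?A (Suc k)) = (\<Sum>\<gamma>\<in>?A k. of_nat (fact k) / of_nat (mi_fact \<gamma>) * B (\<gamma> + unit_index j))" .
  qed
  finally show ?thesis .
qed

section \<open>From formal polynomials to polynomial functions\<close>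

lemma holo_poly_mi_pow: "(\<lambda>z. mi_pow z \<gamma>) \<in> holo_poly"
  unfolding mi_pow_def by (intro holo_poly_prod holo_poly_power holo_poly.coord)

lemma holo_poly_peval: "peval p \<in> holo_poly"
  unfolding peval_def[abs_def] by (intro holo_poly_sum holo_poly.mult holo_poly.const holo_poly_mi_pow)

text \<open>Multiplication by a monomial shifts the support injectively and leaves the coefficients
  unchanged.\<close>

lemma peval_zmonom_mult: "peval (zmonom \<gamma> * p) z = mi_pow z \<gamma> * peval p z"
proof -
  have eq: "zmonom \<gamma> * p = (\<Sum>\<delta>\<in>Poly_Mapping.keys p. Poly_Mapping.single (\<gamma> + \<delta>) (Poly_Mapping.lookup p \<delta>))"
  proof -
    have "p = (\<Sum>\<delta>\<in>Poly_Mapping.keys p. Poly_Mapping.single \<delta> (Poly_Mapping.lookup p \<delta>))"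
      by (rule poly_mapping_eqI) (simp add: lookup_sum lookup_single when_def sum.If_cases in_keys_iff)
    then have "zmonom \<gamma> * p = zmonom \<gamma> * (\<Sum>\<delta>\<in>Poly_Mapping.keys p. Poly_Mapping.single \<delta> (Poly_Mapping.lookup p \<delta>))"
      by (rule arg_cong)
    then show ?thesis
      by (simp add: zmonom_def sum_distrib_left mult_single)
  qed
  have look: "Poly_Mapping.lookup (zmonom \<gamma> * p) (\<gamma> + \<delta>) = Poly_Mapping.lookup p \<delta>" for \<delta>
    by (simp add: eq lookup_sum lookup_single when_def sum.If_cases in_keys_iff)
  \<comment> \<open>An inclusion is enough, since indices outside the support carry coefficient
    0.\<close>
  have sub: "Poly_Mapping.keys (zmonom \<gamma> * p) \<subseteq> (+) \<gamma> ` Poly_Mapping.keys p"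
    using keys_mult[of "zmonom \<gamma>" p] by (auto simp: zmonom_def)
  have "peval (zmonom \<gamma> * p) z = (\<Sum>\<delta>\<in>(+) \<gamma> ` Poly_Mapping.keys p. Poly_Mapping.lookup (zmonom \<gamma> * p) \<delta> * mi_pow z \<delta>)"
    unfolding peval_def by (rule sum.mono_neutral_left) (use sub in \<open>auto simp: in_keys_iff\<close>)
  also have "\<dots> = (\<Sum>\<delta>\<in>Poly_Mapping.keys p. Poly_Mapping.lookup p \<delta> * mi_pow z (\<gamma> + \<delta>))"
    by (subst sum.reindex) (auto simp: look)
  finally show ?thesis
    by (simp add: peval_def mi_pow_add sum_distrib_left mult_ac)
qed

text \<open>Induction on \<open>k\<close> with \<open>f\<close> and \<open>g\<close> arbitrary:
  after Pascal's rule the hypothesis is applied to both functions multiplied by one coordinate. The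
  gradient terms then fall under \<open>sum_dirichlet_coord\<close>, and the boundary terms
  recombine because the squared moduli of the coordinates sum to 1 on the sphere.\<close>

lemma sum_dirichlet_monomials:
  fixes \<mu> :: "(complex ^ 'n::finite) measure"
  assumes fin: "finite_measure \<mu>"
    and sets_mu: "sets \<mu> = sets (restrict_space borel (sphere (0 :: complex ^ 'n) 1))"
    and f: "f \<in> holo_poly" and g: "g \<in> holo_poly"
  shows "(\<Sum>\<gamma> | mi_abs \<gamma> = k. of_nat (fact k) / of_nat (mi_fact \<gamma>) *
            (LINT z:ball 0 1|vol.
               herm (cgrad (\<lambda>z. mi_pow z \<gamma> * f z) z) (cgrad (\<lambda>z. mi_pow z \<gamma> * g z) z)
                 * complex_of_real (poisson \<mu> z)))
       = (LINT z:ball 0 1|vol. herm (cgrad f z) (cgrad g z) * complex_of_real (poisson \<mu> z))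
         + of_nat (k * CARD('n)) * (LINT \<zeta>|\<mu>. f \<zeta> * cnj (g \<zeta>))"
  using f g
proof (induction k arbitrary: f g)
  case 0
  \<comment> \<open>Only the zero index remains, and its monomial and its weight are both 1.\<close>
  have "{\<gamma> :: 'n multi_index. mi_abs \<gamma> = 0} = {0}"
    by (auto simp: mi_abs_def intro!: poly_mapping_eqI)
  then show ?case
    by (simp add: mi_fact_def mi_pow_def)
next
  case (Suc k)
  let ?D = "\<lambda>f g. LINT z:ball 0 1|vol. herm (cgrad f z) (cgrad g z) * complex_of_real (poisson \<mu> z)"
  have "(\<Sum>\<gamma> | mi_abs \<gamma> = Suc k. of_nat (fact (Suc k)) / of_nat (mi_fact \<gamma>) *
          ?D (\<lambda>z. mi_pow z \<gamma> * f z) (\<lambda>z. mi_pow z \<gamma> * g z))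
      = (\<Sum>j\<in>UNIV. \<Sum>\<gamma> | mi_abs \<gamma> = k. of_nat (fact k) / of_nat (mi_fact \<gamma>) *
          ?D (\<lambda>z. mi_pow z \<gamma> * (z $ j * f z)) (\<lambda>z. mi_pow z \<gamma> * (z $ j * g z)))"
    unfolding sum_multinomial_Suc mi_pow_add_unit mult.assoc ..
  also have "\<dots> = (\<Sum>j\<in>UNIV. ?D (\<lambda>z. z $ j * f z) (\<lambda>z. z $ j * g z)
         + of_nat (k * CARD('n)) * (LINT \<zeta>|\<mu>. (\<zeta> $ j * f \<zeta>) * cnj (\<zeta> $ j * g \<zeta>)))"
    by (intro sum.cong refl Suc.IH holo_poly_coord_mult Suc.prems)
  also have "\<dots> = ?D f g + of_nat CARD('n) * (LINT \<zeta>|\<mu>. f \<zeta> * cnj (g \<zeta>))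
         + of_nat (k * CARD('n)) * (\<Sum>j\<in>UNIV. LINT \<zeta>|\<mu>. (\<zeta> $ j * f \<zeta>) * cnj (\<zeta> $ j * g \<zeta>))"
    unfolding sum.distrib sum_dirichlet_coord[OF fin sets_mu Suc.prems] sum_distrib_left[symmetric] ..
  also have "(\<Sum>j\<in>UNIV. LINT \<zeta>|\<mu>. (\<zeta> $ j * f \<zeta>) * cnj (\<zeta> $ j * g \<zeta>)) = (LINT \<zeta>|\<mu>. f \<zeta> * cnj (g \<zeta>))"
  proof -
    interpret finite_measure \<mu>
      by (rule fin)
    have "integrable \<mu> (\<lambda>\<zeta>. (\<zeta> $ j * f \<zeta>) * cnj (\<zeta> $ j * g \<zeta>))" for j
    proof -
      have c: "continuous_on UNIV (\<lambda>\<zeta>. (\<zeta> $ j * f \<zeta>) * cnj (\<zeta> $ j * g \<zeta>))"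
        by (intro continuous_intros continuous_on_holo_poly Suc.prems)
      from continuous_bounded_on_unit_ball[OF c] obtain C where
        "\<And>\<zeta>. norm \<zeta> \<le> 1 \<Longrightarrow> norm ((\<zeta> $ j * f \<zeta>) * cnj (\<zeta> $ j * g \<zeta>)) \<le> C"
        by blast
      then show ?thesis
        by (intro integrable_const_bound[of _ C] AE_I2 borel_measurable_sphere[OF fin sets_mu]
            borel_measurable_continuous_onI[OF c]) (auto simp: space_sphere[OF fin sets_mu])
    qed
    then have "(\<Sum>j\<in>UNIV. LINT \<zeta>|\<mu>. (\<zeta> $ j * f \<zeta>) * cnj (\<zeta> $ j * g \<zeta>))
        = (LINT \<zeta>|\<mu>. (\<Sum>j\<in>UNIV. (\<zeta> $ j * f \<zeta>) * cnj (\<zeta> $ j * g \<zeta>)))"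
      by (intro Bochner_Integration.integral_sum[symmetric])
    also have "\<dots> = (LINT \<zeta>|\<mu>. f \<zeta> * cnj (g \<zeta>))"
    proof (rule Bochner_Integration.integral_cong[OF refl])
      fix \<zeta> assume "\<zeta> \<in> space \<mu>"
      then have "norm \<zeta> = 1"
        by (simp add: space_sphere[OF fin sets_mu])
      then have "(\<Sum>j\<in>UNIV. \<zeta> $ j * cnj (\<zeta> $ j)) = 1"
        unfolding sum_mult_cnj_eq by (simp add: dot_square_norm)
      moreover have "(\<Sum>j\<in>UNIV. (\<zeta> $ j * f \<zeta>) * cnj (\<zeta> $ j * g \<zeta>))
          = (\<Sum>j\<in>UNIV. \<zeta> $ j * cnj (\<zeta> $ j)) * (f \<zeta> * cnj (g \<zeta>))"
        by (simp add: sum_distrib_left sum_distrib_right mult_ac)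
      ultimately show "(\<Sum>j\<in>UNIV. (\<zeta> $ j * f \<zeta>) * cnj (\<zeta> $ j * g \<zeta>)) = f \<zeta> * cnj (g \<zeta>)"
        by simp
    qed
    finally show ?thesis .
  qed
  finally show ?case
    by (simp add: algebra_simps)
qed

theorem theorem2p1:
  fixes \<mu> :: "(complex ^ ('n::finite)) measure"
    and p q :: "'n cpoly"
    and k :: nat
  assumes "finite_measure \<mu>"
    and "sets \<mu> = sets (restrict_space borel (sphere (0 :: complex ^ 'n) 1))"
  shows "(\<Sum>\<gamma> | mi_abs \<gamma> = k. of_nat (fact (mi_abs \<gamma>)) / of_nat (mi_fact \<gamma>) *
            (LINT z:ball 0 1|vol.
               herm (cgrad (peval (zmonom \<gamma> * p)) z) (cgrad (peval (zmonom \<gamma> * q)) z)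
                 * complex_of_real (poisson \<mu> z)))
       = (LINT z:ball 0 1|vol.
            herm (cgrad (peval p) z) (cgrad (peval q) z) * complex_of_real (poisson \<mu> z))
         + of_nat (k * CARD('n)) * (LINT \<zeta>|\<mu>. peval p \<zeta> * cnj (peval q \<zeta>))"
proof -
  \<comment> \<open>The product in the polynomial ring becomes a pointwise product, so the identity
    for functions applies; on the index set, \<open>mi_abs \<gamma>\<close> is
    \<open>k\<close>.\<close>
  have "peval (zmonom \<gamma> * p) = (\<lambda>z. mi_pow z \<gamma> * peval p z)" for \<gamma> and p :: "'n cpoly"
    by (rule ext) (rule peval_zmonom_mult)
  then show ?thesis
    using sum_dirichlet_monomials[OF assms holo_poly_peval[of p] holo_poly_peval[of q], of k] by simp
qed

end
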